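(* Fix a sufficiently small $\epsilon>0$ and a sufficiently large $M$, and suppose $F(t,\eta,\lambda)$ satisfies the following properties: 1. for every $(\eta,\lambda)\in\Omega_+\times B^0(0,\epsilon)$, $F(t,\eta,\lambda)$ is analytic in $t\in B(1/2,1/2)$; 2. $F(t,\eta,\lambda)$ is continuous in all variables in $B(1/2,1/2)\times\Omega_+\times B^0(0,\epsilon)$ and for every $t\in B(1/2,1/2)$ it is bounded in $(\eta,\lambda)\in\Omega_+\times B^0(0,\epsilon)$; 3. $F(t,\eta,\lambda)=O(t^{c_0})$ as $t\to0$, where $c_0>-1$, uniformly in $(\eta,\lambda)\in\Omega_+\times B^0(0,\epsilon)$; 4. $F(t,\eta,\lambda)=O((1-t)^{c_1})$ as $t\to1$, where $c_1>-1$, uniformly in $(\eta,\lambda)\in\Omega_+\times B^0(0,\epsilon)$; 5. $|F(t_-^*(\eta),\eta,\lambda)|$ is separated from zero for all $(\eta,\lambda)\in\Omega_+\times B^0(0,\epsilon)$. Then $$\int_0^1F(t,\eta,\lambda)e^{-\Im[a(\lambda)]S_\eta(t)}dt=e^{-\Im[a(\lambda)]S_\eta(t^*_-(\eta))}F\left(t^*_-(\eta),\eta,\lambda\right)\sqrt{\frac{2\pi}{\Im[a(\lambda)]S''_\eta(t^*_-(\eta))}}\left[1+O\left(\frac{M^2}{\Im[a(\lambda)]}\right)\right]$$ as $\lambda\to0$, and this approximation is uniform for $\eta\in\Omega_+$.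
   Context: $B(\zeta,r)$ and $B^0(\zeta,r)$ are the open disc and punctured open disc of radius $r$ centred at $\zeta\in\mathbb C$. $\Im$ is imaginary part. $M>0$ is a fixed number and $\Omega_+=\{\eta\in\mathbb C: M\le|\eta|\le2M,\ 0\le\arg\eta\le\pi\}$. $S_\eta(t)=-i\ln\left(\frac{t(1-t)}{1-t/\eta}\right)$, with branch cuts in $t$ along $(-\infty,0)$, $(1,\infty)$ and the ray from $t=\eta$ to $\infty$ with angle $\arg\eta$ (i.e. $S_\eta(t)=-i[\ln t+\ln(1-t)-\ln(1-t/\eta)]$ with principal logarithms); $''$ is the second derivative in $t$. $t_-^*(\eta)=\eta-\sqrt{\eta^2-\eta}$, where the square root has branch cut $[0,1]$ and $\sqrt{\eta^2-\eta}\sim\eta$ at infinity, so $t^*_-(\eta)=\frac12+O(\eta^{-1})$; it is a simple saddle point, $S'_\eta(t^*_-(\eta))=0$, with $S_\eta(t^*_-(\eta))=-2i\ln t^*_-(\eta)$, $S_\eta''(t^*_-(\eta))=\frac{2i}{t^*_-(\eta)(1-t^*_-(\eta))}$. The square root in the conclusion is the principal branch. $a(\lambda)=\frac{1}{i\pi}\ln\left(\frac{i+\sqrt{4\lambda^2-1}}{2\lambda}\right)$ with principal logarithm and $\sqrt{4\lambda^2-1}=2\lambda+O(1)$ as $\lambda\to\infty$ (cut $[-1/2,1/2]$). Here $\lambda\in\mathbb C\setminus[-1/2,1/2]$, where $\lambda$ on the upper or lower shore of $[-1/2,1/2]$ is also allowed (with boundary values of $a$); $\lambda\to0$ is taken within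 either $\Im\lambda\ge0$ or $\Im\lambda\le0$.
   Formalization: In condition 2, boundedness in (η,λ) "for every t" is strengthened to boundedness uniform for t near each point of B(1/2,1/2) (equivalently, on compact subsets); with the bound only at each single t the claim is false, by a Runge-type counterexample. *)

theory Defs
  imports "HOL-Complex_Analysis.Complex_Analysis"
begin

definition Omega_plus :: "real \<Rightarrow> complex set" where
  "Omega_plus M = {\<eta>. M \<le> norm \<eta> \<and> norm \<eta> \<le> 2 * M \<and> 0 \<le> Arg \<eta> \<and> Arg \<eta> \<le> pi}"

definition punctured_ball :: "complex \<Rightarrow> real \<Rightarrow> complex set" where
  "punctured_ball \<zeta> r = ball \<zeta> r - {\<zeta>}"

definition S_phase :: "complex \<Rightarrow> complex \<Rightarrow> complex" where
  "S_phase \<eta> t = - \<i> * (Ln t + Ln (1 - t) - Ln (1 - t / \<eta>))"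

text \<open>The square root of \<open>\<eta>\<^sup>2 - \<eta>\<close> is written as \<open>\<eta>\<close> times the principal root of
  \<open>1 - 1 / \<eta>\<close>: the latter is cut exactly where \<open>1 - 1 / \<eta>\<close> is a nonpositive real, that is on
  \<open>(0, 1]\<close>, and it tends to 1 at infinity.\<close>

definition saddle_minus :: "complex \<Rightarrow> complex" where
  "saddle_minus \<eta> = \<eta> - \<eta> * csqrt (1 - 1 / \<eta>)"

text \<open>Likewise, \<open>root_lam\<close> is the branch of the square root of \<open>4\<lambda>\<^sup>2 - 1\<close> with cut
  \<open>[-1/2, 1/2]\<close> and behaviour \<open>2\<lambda> + O(1)\<close> at infinity.\<close>

definition root_lam :: "complex \<Rightarrow> complex" where
  "root_lam l = 2 * l * csqrt (1 - 1 / (4 * l\<^sup>2))"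

definition a_cut_plane :: "complex \<Rightarrow> complex" where
  "a_cut_plane l = 1 / (\<i> * complex_of_real pi) * Ln ((\<i> + root_lam l) / (2 * l))"

text \<open>The function \<open>a\<close> on the closed half-plane \<open>0 \<le> s * Im l\<close> for \<open>s = 1\<close> or \<open>s = -1\<close>: a point of
  \<open>[-1/2, 1/2]\<close> is regarded as lying on the upper (\<open>s = 1\<close>) or lower (\<open>s = -1\<close>) shore, and
  \<open>a\<close> takes there its boundary value from the corresponding open half-plane.\<close>

definition a_shore :: "real \<Rightarrow> complex \<Rightarrow> complex" where
  "a_shore s l = (if l \<in> closed_segment (- 1 / 2) (1 / 2)
                  then Lim (at l within {z. 0 < s * Im z}) a_cut_plane
                  else a_cut_plane l)"

end

theory Submission
  imports Defs "HOL-Probability.Distributions"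
begin

text \<open>Write \<open>k = \<bar>\<kappa>\<bar>\<close> and \<open>\<sigma> = sgn \<kappa>\<close>. Since \<open>exp (i S(t)) = t (1 - t) / (1 - t / \<eta>)\<close> is rational of degree
  two, the descent path through the saddle \<open>\<tau>\<close> can be parametrised explicitly: with
  \<open>\<omega>\<^sup>2 = - i \<sigma> \<tau> (1 - \<tau>)\<close> and \<open>t = \<tau> + \<omega> x\<close> one finds
  \<open>exp (i (S(t) - S(\<tau>))) = 1 + i \<sigma> x\<^sup>2 / (1 - \<beta> x)\<close> where \<open>\<beta> = \<omega> / (\<eta> - \<tau>)\<close>, and solving
  \<open>x\<^sup>2 = v\<^sup>2 (1 - \<beta> x)\<close> for \<open>x = x(v)\<close> turns the exponential factor into
  \<open>exp (i \<sigma> k Ln (1 + i \<sigma> v\<^sup>2))\<close>, an even function of \<open>v\<close> that does not depend on \<open>\<eta>\<close> and is close to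
  \<open>exp (- k v\<^sup>2)\<close>. Evenness removes the linear term of the amplitude, whose quadratic remainder is bounded by
  Cauchy's inequality, so the relative error is \<open>O(1 / k)\<close>, uniformly in \<open>\<eta>\<close>.

  The path is completed by the straight segments from \<open>0\<close> to its start and from its end to \<open>1\<close>. For large
  \<open>\<bar>\<eta>\<bar>\<close> they are small perturbations of the case \<open>\<eta> = \<infinity>\<close>, and on them \<open>\<sigma> Re S\<close> exceeds its value at
  the saddle by a fixed amount, which makes their contribution exponentially small. The deformation of \<open>[0, 1]\<close> is
  carried out with a primitive of the integrand on the disc, which has limits at \<open>0\<close> and \<open>1\<close> because the
  exponents \<open>c\<^sub>0, c\<^sub>1\<close> exceed \<open>-1\<close>. Finally \<open>\<bar>Im (a(\<lambda>))\<bar> \<ge> 1\<close> for all small \<open>\<lambda>\<close>, the sign being determined by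
  the half-plane; both signs are covered by \<open>\<sigma>\<close>.\<close>

section \<open>Primitives at an endpoint singularity\<close>

text \<open>Along a ray into \<open>e\<close> the integrand is \<open>O(r powr c)\<close> with
  \<open>c > -1\<close>, so \<open>\<Phi>\<close> has a limit there. Two rays share this limit: at
  scale \<open>s\<close> their points are \<open>s * norm (P - Q)\<close> apart and \<open>f\<close>
  is at most \<open>A * s powr c\<close> between them, so the values of \<open>\<Phi>\<close> differ
  by \<open>O(s powr (c + 1))\<close>. The constant \<open>L\<close> thus serves as the value of
  \<open>\<Phi>\<close> at \<open>e\<close>.\<close>

lemma primitive_limit_at_endpoint:
  fixes f \<Phi> :: "complex \<Rightarrow> complex" and e :: complex and c A :: real
  assumes c: "-1 < c" and D: "convex D"
    and der: "\<And>z. z \<in> U \<Longrightarrow> (\<Phi> has_field_derivative f z) (at z)"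
    and cont: "continuous_on U f"
    and sub: "\<And>P r. P \<in> D \<Longrightarrow> 0 < r \<Longrightarrow> r \<le> 1 \<Longrightarrow> e + of_real r * (P - e) \<in> U"
    and bd: "\<And>P r. P \<in> D \<Longrightarrow> 0 < r \<Longrightarrow> r \<le> 1 \<Longrightarrow> norm (f (e + of_real r * (P - e))) \<le> A * r powr c"
  shows "\<exists>L. \<forall>P\<in>D. (\<lambda>r. f (e + of_real r * (P - e))) absolutely_integrable_on {0..1} \<and>
           (P - e) * integral {0..1} (\<lambda>r. f (e + of_real r * (P - e))) = \<Phi> P - L"
proof -
  define h where "h = (\<lambda>P (r::real). f (e + of_real r * (P - e)))"
  have powr_int: "(\<lambda>r. A * r powr c) integrable_on {0<..<1}"
    using integrable_on_powr_from_0[OF c, of 1]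
    by (intro integrable_on_mult_right) (simp add: integrable_on_Icc_iff_Ioo)
  have ai: "h P absolutely_integrable_on {0..1}" if P: "P \<in> D" for P
  proof -
    \<comment> \<open>The open interval is used because \<open>e\<close> itself need not lie in
      \<open>U\<close>.\<close>
    have "continuous_on {0<..<1} (h P)"
      unfolding h_def using sub[OF P]
      by (intro continuous_on_compose2[OF cont] continuous_intros) auto
    then have "h P absolutely_integrable_on {0<..<1}"
      using bd[OF P] powr_int
      by (intro measurable_bounded_by_integrable_imp_absolutely_integrable[where g = "\<lambda>r. A * r powr c"]
          continuous_imp_measurable_on_sets_lebesgue) (auto simp: h_def)
    then show ?thesis
      using absolutely_integrable_on_open_interval[where f = "h P" and a = "0::real" and b = 1] by simp
  qed
  define L where "L = (\<lambda>P. \<Phi> P - (P - e) * integral {0..1} (h P))"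
  have ftc: "\<Phi> (e + of_real s * (P - e)) = \<Phi> P - (P - e) * integral {s..1} (h P)"
    if P: "P \<in> D" and s: "0 < s" "s \<le> 1" for P s
  proof -
    have "((\<lambda>r. \<Phi> (e + of_real r * (P - e))) has_vector_derivative (P - e) * h P r) (at r within {s..1})"
      if r: "r \<in> {s..1}" for r
    proof -
      have "((\<lambda>r. e + of_real r * (P - e)) has_vector_derivative (P - e)) (at r within {s..1})"
        by (auto intro!: derivative_eq_intros simp: has_vector_derivative_def scaleR_conv_of_real)
      then show ?thesis
        using field_vector_diff_chain_within[of "\<lambda>r. e + of_real r * (P - e)" "P - e" r "{s..1}" \<Phi> "h P r"]
          der[OF sub[OF P, of r]] r s
        by (auto simp: h_def o_def intro: has_field_derivative_at_within)
    qed
    then have "((\<lambda>r. (P - e) * h P r) has_integral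
        (\<Phi> (e + of_real 1 * (P - e)) - \<Phi> (e + of_real s * (P - e)))) {s..1}"
      by (rule fundamental_theorem_of_calculus[OF s(2)])
    then have "integral {s..1} (\<lambda>r. (P - e) * h P r) = \<Phi> P - \<Phi> (e + of_real s * (P - e))"
      by (subst integral_unique) auto
    then show ?thesis by simp
  qed
  have lim: "((\<lambda>s. \<Phi> (e + of_real s * (P - e))) \<longlongrightarrow> L P) (at_right 0)" if P: "P \<in> D" for P
  proof -
    have "h P integrable_on {0..1}"
      using ai[OF P] absolutely_integrable_on_def by blast
    then have "((\<lambda>s. integral {s..1} (h P)) \<longlongrightarrow> integral {0..1} (h P)) (at 0 within {0..1})"
      using indefinite_integral_continuous_1'[of "h P" 0 1] by (auto simp: continuous_on_def)
    then have "((\<lambda>s. integral {s..1} (h P)) \<longlongrightarrow> integral {0..1} (h P)) (at_right 0)"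
      by (simp add: at_within_Icc_at_right)
    then have "((\<lambda>s. \<Phi> P - (P - e) * integral {s..1} (h P)) \<longlongrightarrow> L P) (at_right 0)"
      unfolding L_def by (intro tendsto_intros)
    moreover have "\<forall>\<^sub>F s in at_right 0. \<Phi> P - (P - e) * integral {s..1} (h P) = \<Phi> (e + of_real s * (P - e))"
      using eventually_at_right_real[of 0 "1::real", OF zero_less_one] by eventually_elim (use ftc[OF P] in auto)
    ultimately show ?thesis
      by (rule Lim_transform_eventually)
  qed
  have same: "L P = L Q" if P: "P \<in> D" and Q: "Q \<in> D" for P Q
  proof -
    have bound: "norm (\<Phi> (e + of_real s * (P - e)) - \<Phi> (e + of_real s * (Q - e)))
        \<le> A * norm (P - Q) * s powr (c + 1)" if s: "0 < s" "s < 1" for s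
    proof -
      let ?g = "\<lambda>z. e + of_real s * (z - e)"
      have img: "z \<in> ?g ` closed_segment P Q" if z: "z \<in> closed_segment (?g P) (?g Q)" for z
      proof -
        from z obtain u where u: "0 \<le> u" "u \<le> 1" "z = (1 - u) *\<^sub>R ?g P + u *\<^sub>R ?g Q"
          by (auto simp: in_segment)
        then have "z = ?g ((1 - u) *\<^sub>R P + u *\<^sub>R Q)"
          by (simp add: scaleR_conv_of_real algebra_simps)
        moreover have "(1 - u) *\<^sub>R P + u *\<^sub>R Q \<in> closed_segment P Q"
          using u by (auto simp: in_segment)
        ultimately show ?thesis by blast
      qed
      have "closed_segment P Q \<subseteq> D"
        using D P Q by (simp add: closed_segment_subset)
      then have "(\<Phi> has_field_derivative f z) (at z within closed_segment (?g P) (?g Q)) \<and>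
          norm (f z) \<le> A * s powr c" if "z \<in> closed_segment (?g P) (?g Q)" for z
        using img[OF that] s sub bd by (auto intro!: has_field_derivative_at_within der)
      then have "norm (\<Phi> (?g P) - \<Phi> (?g Q)) \<le> A * s powr c * norm (?g P - ?g Q)"
        by (intro field_differentiable_bound[of "closed_segment (?g P) (?g Q)"]) auto
      also have "norm (?g P - ?g Q) = s * norm (P - Q)"
        using s by (simp add: norm_mult flip: right_diff_distrib)
      finally show ?thesis
        using s by (simp add: powr_add mult_ac)
    qed
    have "((\<lambda>s. s powr (c + 1)) \<longlongrightarrow> 0 powr (c + 1)) (at_right (0::real))"
      using c by (intro tendsto_powr') (auto simp: eventually_at_filter intro!: tendsto_intros)
    then have "((\<lambda>s. s powr (c + 1)) \<longlongrightarrow> 0) (at_right (0::real))"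
      by simp
    then have lim0: "((\<lambda>s. A * norm (P - Q) * s powr (c + 1)) \<longlongrightarrow> 0) (at_right 0)"
      by (rule tendsto_mult_right_zero)
    have "\<forall>\<^sub>F s in at_right 0. norm (\<Phi> (e + of_real s * (P - e)) - \<Phi> (e + of_real s * (Q - e)))
        \<le> A * norm (P - Q) * s powr (c + 1)"
      by (rule eventually_mono[OF eventually_at_right_real[OF zero_less_one]]) (use bound in simp)
    then have "((\<lambda>s. \<Phi> (e + of_real s * (P - e)) - \<Phi> (e + of_real s * (Q - e))) \<longlongrightarrow> 0) (at_right 0)"
      using lim0 by (rule Lim_null_comparison)
    moreover have "((\<lambda>s. \<Phi> (e + of_real s * (P - e)) - \<Phi> (e + of_real s * (Q - e))) \<longlongrightarrow> L P - L Q) (at_right 0)"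
      by (intro tendsto_intros lim P Q)
    ultimately have "L P - L Q = 0"
      using tendsto_unique[OF trivial_limit_at_right_real] by fast
    then show ?thesis by simp
  qed
  show ?thesis
  proof (cases "D = {}")
    case False
    then obtain P0 where P0: "P0 \<in> D" by blast
    show ?thesis
      by (rule exI[of _ "L P0"]) (use ai same[OF P0] in \<open>auto simp: L_def h_def\<close>)
  qed auto
qed

section \<open>Bounds near the endpoints, uniform in the parameters\<close>

text \<open>A finite subcover turns locally uniform bounds into one bound common to all
  indices.\<close>

lemma compact_family_bound:
  fixes F :: "complex \<Rightarrow> 'i \<Rightarrow> complex"
  assumes loc: "\<forall>t\<^sub>0\<in>U. \<exists>r>0. \<exists>B. \<forall>t\<in>U \<inter> ball t\<^sub>0 r. \<forall>i\<in>I. norm (F t i) \<le> B"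
    and K: "compact K" "K \<subseteq> U"
  shows "\<exists>B. \<forall>t\<in>K. \<forall>i\<in>I. norm (F t i) \<le> B"
proof -
  have "\<forall>t\<^sub>0\<in>K. \<exists>r. r > 0 \<and> (\<exists>B. \<forall>t\<in>U \<inter> ball t\<^sub>0 r. \<forall>i\<in>I. norm (F t i) \<le> B)"
    using loc K(2) by blast
  then obtain r where r: "\<And>t\<^sub>0. t\<^sub>0 \<in> K \<Longrightarrow> r t\<^sub>0 > 0"
      "\<And>t\<^sub>0. t\<^sub>0 \<in> K \<Longrightarrow> \<exists>B. \<forall>t\<in>U \<inter> ball t\<^sub>0 (r t\<^sub>0). \<forall>i\<in>I. norm (F t i) \<le> B"
    by metis
  then obtain B where B: "\<And>t\<^sub>0 t i. t\<^sub>0 \<in> K \<Longrightarrow> t \<in> U \<inter> ball t\<^sub>0 (r t\<^sub>0) \<Longrightarrow> i \<in> I \<Longrightarrow> norm (F t i) \<le> B t\<^sub>0"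
    by metis
  have "K \<subseteq> (\<Union>t\<in>K. ball t (r t))"
    using r(1) by force
  then obtain T where T: "T \<subseteq> K" "finite T" "K \<subseteq> (\<Union>t\<in>T. ball t (r t))"
    by (rule compactE_image[OF K(1) open_ball])
  show ?thesis
  \<comment> \<open>The sum of absolute values replaces a maximum, which would require
    \<open>T\<close> to be nonempty.\<close>
  proof (intro exI[of _ "\<Sum>t\<in>T. \<bar>B t\<bar>"] ballI)
    fix t i assume ti: "t \<in> K" "i \<in> I"
    obtain t0 where t0: "t0 \<in> T" "t \<in> ball t0 (r t0)" using T(3) ti(1) by blast
    have "norm (F t i) \<le> \<bar>B t0\<bar>"
      using B[of t0 t i] t0 T(1) ti K(2) by force
    also have "\<dots> \<le> (\<Sum>t\<in>T. \<bar>B t\<bar>)"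
      using T(2) t0(1) by (intro member_le_sum) auto
    finally show "norm (F t i) \<le> (\<Sum>t\<in>T. \<bar>B t\<bar>)" .
  qed
qed

text \<open>Since \<open>r * (2/5) + (1 - r) / 2 = 1/2 - r / 10\<close>, the scaled disc keeps a
  distance of at least \<open>r / 10\<close> from the bounding circle.\<close>

lemma cone_in_ball:
  fixes P :: complex
  assumes P: "P \<in> cball (1/2) (2/5)" and r: "0 < r" "r \<le> 1"
  shows "norm (of_real r * P - 1/2) \<le> 1/2 - r / 10" "1/10 \<le> norm P" "norm P \<le> 9/10"
proof -
  have d: "norm (P - 1/2) \<le> 2/5"
    using P by (simp add: dist_norm norm_minus_commute)
  have "of_real r * P - 1/2 = of_real r * (P - 1/2) - of_real ((1 - r) / 2)"
    by (simp add: field_simps)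
  also have "norm \<dots> \<le> norm (of_real r * (P - 1/2)) + norm (of_real ((1 - r) / 2) :: complex)"
    by (rule norm_triangle_ineq4)
  also have "norm (of_real r * (P - 1/2)) \<le> r * (2/5)"
    using d r by (simp add: norm_mult)
  also have "norm (of_real ((1 - r) / 2) :: complex) = (1 - r) / 2"
    using r by (simp only: norm_of_real) simp
  finally show "norm (of_real r * P - 1/2) \<le> 1/2 - r / 10" by (simp add: field_simps)
  show "1/10 \<le> norm P" "norm P \<le> 9/10"
    using d norm_triangle_ineq2[of "1/2" "1/2 - P"] norm_triangle_ineq[of "P - 1/2" "1/2"]
    by (simp_all add: norm_minus_commute)
qed

text \<open>Applied with \<open>g t = t\<close> and \<open>g t = 1 - t\<close>. The points with \<open>g t = r P\<close> lie in a cone at the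
  endpoint, where \<open>t\<close> stays away from the boundary of the disc in proportion to \<open>r\<close>.\<close>

lemma endpoint_cone_bound:
  fixes F :: "complex \<Rightarrow> 'i \<Rightarrow> complex" and g :: "complex \<Rightarrow> complex"
  assumes loc: "\<forall>t\<^sub>0\<in>ball (1/2) (1/2). \<exists>r>0. \<exists>B. \<forall>t\<in>ball (1/2) (1/2) \<inter> ball t\<^sub>0 r. \<forall>i\<in>I. norm (F t i) \<le> B"
    and g: "\<And>t. norm (t - 1/2) = norm (g t - 1/2)"
    and \<delta>: "\<delta> > 0" and near: "\<forall>t\<in>ball (1/2) (1/2). norm (g t) < \<delta> \<longrightarrow> (\<forall>i\<in>I. norm (F t i) \<le> K * norm (g t) powr c\<^sub>0)"
    and c: "c \<le> c\<^sub>0" "c \<le> 0"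
  shows "\<exists>A\<ge>0. \<forall>i\<in>I. \<forall>P\<in>cball (1/2) (2/5). \<forall>r. \<forall>t. 0 < r \<and> r \<le> 1 \<and> g t = of_real r * P
           \<longrightarrow> norm (F t i) \<le> A * r powr c"
proof -
  \<comment> \<open>If \<open>norm (g t) \<ge> \<delta>\<close>, then
    \<open>r \<ge> \<delta>\<close>, so the cone estimate places \<open>t\<close> in this smaller
    closed disc.\<close>
  have "\<exists>B. \<forall>t\<in>cball (1/2) (1/2 - \<delta>/10). \<forall>i\<in>I. norm (F t i) \<le> B"
    using \<delta> by (intro compact_family_bound[OF loc]) auto
  then obtain B where B: "\<And>t i. t \<in> cball (1/2) (1/2 - \<delta>/10) \<Longrightarrow> i \<in> I \<Longrightarrow> norm (F t i) \<le> B"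
    by blast
  \<comment> \<open>As \<open>c \<le> 0\<close>, the factor \<open>(1/10) powr c\<close> absorbs
    \<open>norm P powr c\<close>, and the constant bound \<open>B\<close> may be multiplied by
    \<open>r powr c \<ge> 1\<close>.\<close>
  define A where "A = \<bar>K\<bar> * (1/10) powr c + \<bar>B\<bar>"
  have "norm (F t i) \<le> A * r powr c"
    if i: "i \<in> I" and P: "P \<in> cball (1/2) (2/5)" and r: "0 < r" "r \<le> 1" and t: "g t = of_real r * P" for i P r t
  proof -
    note cone = cone_in_ball[OF P r]
    have gt: "norm (g t) = r * norm P" using r by (simp add: t norm_mult)
    have dt: "norm (t - 1/2) \<le> 1/2 - r / 10" unfolding g[of t] t by (rule cone(1))
    then have tb: "t \<in> ball (1/2) (1/2)"
      using r by (simp add: dist_norm norm_minus_commute)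
    have rc: "1 \<le> r powr c"
      using powr_mono'[of c 0 r] r c by simp
    show ?thesis
    proof (cases "norm (g t) < \<delta>")
      case True
      have g1: "norm (g t) \<le> 1"
        unfolding gt using r cone by (intro mult_le_one) auto
      have "norm (F t i) \<le> K * norm (g t) powr c\<^sub>0"
        using near tb True i by blast
      also have "\<dots> \<le> \<bar>K\<bar> * norm (g t) powr c"
        using powr_mono'[OF c(1) _ g1] by (intro mult_mono) auto
      also have "norm (g t) powr c = r powr c * norm P powr c"
        using r by (simp add: gt powr_mult)
      also have "\<bar>K\<bar> * (r powr c * norm P powr c) \<le> \<bar>K\<bar> * (r powr c * (1/10) powr c)"
        using powr_mono2'[OF c(2) _ cone(2)] by (intro mult_left_mono) auto
      also have "\<dots> \<le> A * r powr c"
        by (simp add: A_def algebra_simps)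
      finally show ?thesis .
    next
      case False
      then have "\<delta> \<le> r * norm P" using gt by simp
      also have "\<dots> \<le> r * 1" using r cone by (intro mult_left_mono) auto
      finally have "t \<in> cball (1/2) (1/2 - \<delta>/10)"
        using dt by (simp add: dist_norm norm_minus_commute)
      then have "norm (F t i) \<le> \<bar>B\<bar> * 1"
        using B i by force
      also have "\<dots> \<le> \<bar>B\<bar> * r powr c"
        using rc by (intro mult_left_mono) auto
      also have "\<dots> \<le> A * r powr c"
        by (intro mult_right_mono) (auto simp: A_def)
      finally show ?thesis .
    qed
  qed
  moreover have "A \<ge> 0" by (simp add: A_def)
  ultimately show ?thesis by blast
qed

text \<open>Serves to assemble the integral over \<open>[0, 1]\<close> from two radial integrals,
  one leaving each endpoint and both ending at \<open>1/2\<close>.\<close>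

lemma has_integral_halves:
  fixes g :: "real \<Rightarrow> 'a::banach"
  assumes "(g has_integral J) {0..1}"
  shows "((\<lambda>x. g (2 * x)) has_integral (1/2) *\<^sub>R J) {0..1/2}"
    and "((\<lambda>x. g (2 - 2 * x)) has_integral (1/2) *\<^sub>R J) {1/2..1}"
proof -
  show "((\<lambda>x. g (2 * x)) has_integral (1/2) *\<^sub>R J) {0..1/2}"
    using has_integral_affinity'[of g J 0 "1::real" 2 0] assms by simp
  have "(\<lambda>x. (1 / - 2) *\<^sub>R x + - ((1 / - 2) *\<^sub>R 2)) ` {0..1} = {1/2..1::real}"
    using image_affinity_atLeastAtMost[of "- (1/2)" 1 0 "1::real"] by simp
  then show "((\<lambda>x. g (2 - 2 * x)) has_integral (1/2) *\<^sub>R J) {1/2..1}"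
    using has_integral_affinity[of g J 0 "1::real" "- 2" 2] assms by simp
qed

section \<open>The Laplace-type kernel\<close>

text \<open>This is the normalisation of the normal density with variance
  \<open>1 / (2 * k)\<close>.\<close>

lemma has_integral_gaussian:
  fixes k :: real
  assumes "k > 0"
  shows "((\<lambda>v. exp (- k * v\<^sup>2)) has_integral sqrt (pi / k)) UNIV"
proof -
  define \<sigma> where "\<sigma> = sqrt (1 / (2 * k))"
  have s2: "\<sigma>\<^sup>2 = 1 / (2 * k)"
    unfolding \<sigma>_def using assms by simp
  have "\<sigma> > 0" unfolding \<sigma>_def using assms by simp
  have "(normal_density 0 \<sigma> has_integral 1) UNIV"
    using has_integral_integral_lborel[OF integrable_normal_density[of \<sigma> 0]] \<open>\<sigma> > 0\<close> by simp
  then have "((\<lambda>v. sqrt (pi / k) * normal_density 0 \<sigma> v) has_integral sqrt (pi / k) * 1) UNIV"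
    by (rule has_integral_mult_right)
  moreover have "sqrt (pi / k) * normal_density 0 \<sigma> v = exp (- k * v\<^sup>2)" for v
    using assms by (simp add: normal_density_def s2 mult.commute)
  ultimately show ?thesis by simp
qed

text \<open>On \<open>[0, 1]\<close> the derivative \<open>1 / (1 + u\<^sup>2)\<close> is at least
  \<open>1/2\<close>.\<close>

lemma arctan_diff_ge:
  assumes "0 \<le> y" "y \<le> x" "x \<le> 1"
  shows "(x - y) / 2 \<le> arctan x - arctan y"
proof -
  have "arctan y - y / 2 \<le> arctan x - x / 2"
  proof (rule DERIV_nonneg_imp_nondecreasing[of y x "\<lambda>x. arctan x - x / 2"])
    fix u assume u: "y \<le> u" "u \<le> x"
    have "u\<^sup>2 \<le> 1" using u assms by (simp add: power_le_one)
    then have "inverse (1 + u\<^sup>2) - 1 / 2 \<ge> 0" by (simp add: field_simps add_pos_nonneg)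
    then show "\<exists>d. ((\<lambda>x. arctan x - x / 2) has_real_derivative d) (at u) \<and> 0 \<le> d"
      by (intro exI[of _ "inverse (1 + u\<^sup>2) - 1 / 2"]) (auto intro!: derivative_eq_intros)
  qed (use assms in auto)
  then show ?thesis by (simp add: field_simps)
qed

text \<open>The real part equals \<open>- arctan y\<close>, and the linear approximation of
  \<open>Ln\<close> at 1 gives the second bound. With \<open>y = v\<^sup>2\<close> this compares the
  exponent of the kernel with that of a Gaussian.\<close>

lemma Ln_1_plus_i_real:
  fixes y :: real assumes "0 \<le> y" "y \<le> 1/4" "\<sigma> \<in> {1, -1}"
  shows "Re (\<i> * of_real \<sigma> * Ln (1 + \<i> * of_real (\<sigma> * y))) \<le> - y / 2"
    and "norm (\<i> * of_real \<sigma> * Ln (1 + \<i> * of_real (\<sigma> * y)) - of_real (- y)) \<le> 2 * y\<^sup>2"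
proof -
  let ?L = "Ln (1 + \<i> * of_real (\<sigma> * y))"
  have "Im ?L = arctan (\<sigma> * y)"
    using arg_conv_arctan[of "1 + \<i> * of_real (\<sigma> * y)"]
    by (subst Arg_eq_Im_Ln[symmetric]) (auto simp: complex_eq_iff)
  moreover have "\<sigma> * arctan (\<sigma> * y) = arctan y"
    using assms(3) by (auto simp: arctan_minus)
  ultimately have re: "Re (\<i> * of_real \<sigma> * ?L) = - arctan y"
    by simp
  have "y / 2 \<le> arctan y"
    using arctan_diff_ge[of 0 y] assms by simp
  then show "Re (\<i> * of_real \<sigma> * ?L) \<le> - y / 2" using re by linarith
  have nz: "norm (\<i> * of_real (\<sigma> * y)) = y"
    using assms by (auto simp: norm_mult)
  have "\<i> * of_real \<sigma> * ?L - of_real (- y) = \<i> * of_real \<sigma> * (?L - \<i> * of_real (\<sigma> * y))"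
    using assms(3) by (auto simp: algebra_simps)
  also have "norm \<dots> = norm (?L - \<i> * of_real (\<sigma> * y))"
    using assms(3) by (auto simp: norm_mult)
  also have "\<dots> \<le> y\<^sup>2 / (1 - y)"
    using Ln_approx_linear[of "\<i> * of_real (\<sigma> * y)"] nz assms by simp
  also have "\<dots> \<le> y\<^sup>2 * 2"
    using mult_left_mono[of "1 / (1 - y)" 2 "y\<^sup>2"] assms by (simp add: field_simps)
  finally show "norm (\<i> * of_real \<sigma> * ?L - of_real (- y)) \<le> 2 * y\<^sup>2" by simp
qed

text \<open>The mean value inequality on a half-plane, where the derivative of \<open>exp\<close> is
  at most \<open>exp m\<close> in norm.\<close>

lemma norm_exp_diff_le:
  fixes a b :: complex
  assumes "Re a \<le> m" "Re b \<le> m"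
  shows "norm (exp a - exp b) \<le> exp m * norm (a - b)"
proof (rule field_differentiable_bound[of "{z. Re z \<le> m}" exp exp])
  show "convex {z. Re z \<le> m}"
    by (rule convex_halfspace_Re_le)
qed (use assms in \<open>auto intro!: derivative_eq_intros\<close>)

lemma mult_exp_minus_le:
  fixes a y :: real
  assumes a: "a > 0"
  shows "y * exp (- a * y) \<le> 1 / a"
proof -
  have "a * y \<le> exp (a * y)" using exp_ge_add_one_self[of "a * y"] by linarith
  then have "a * y * exp (- (a * y)) \<le> exp (a * y) * exp (- (a * y))"
    by (rule mult_right_mono) simp
  also have "\<dots> = 1" by (simp flip: exp_add)
  finally show ?thesis using a by (simp add: field_simps)
qed

lemma power2_mult_exp_minus_le:
  fixes a y :: real
  assumes a: "a > 0" and y: "y \<ge> 0"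
  shows "y\<^sup>2 * exp (- a * y) \<le> 2 / a\<^sup>2"
proof -
  have "0 \<le> a * y" using a y by simp
  then have "1 + a * y + (a * y)\<^sup>2 / 2 \<le> exp (a * y)"
    by (rule exp_lower_Taylor_quadratic)
  then have "(a * y)\<^sup>2 \<le> 2 * exp (a * y)" using \<open>0 \<le> a * y\<close> by linarith
  then have "(a * y)\<^sup>2 * exp (- (a * y)) \<le> 2 * exp (a * y) * exp (- (a * y))"
    by (rule mult_right_mono) simp
  also have "\<dots> = 2" by (simp flip: exp_add)
  finally show ?thesis using a by (simp add: field_simps power_mult_distrib)
qed

text \<open>The kernel is even, so only the even part of \<open>G\<close> matters, and it differs
  from \<open>G0\<close> by at most \<open>C * v\<^sup>2\<close>. The integrand, extended by zero,
  is compared pointwise with \<open>G0 * exp (- k * v\<^sup>2)\<close> on the whole line; the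
  difference lies below a Gaussian of height \<open>O(1 / k)\<close>, whose integral is
  \<open>O(1 / (k * sqrt k))\<close>.\<close>

lemma laplace_kernel_estimate:
  fixes G :: "real \<Rightarrow> complex" and k C :: real
  assumes cont: "continuous_on {-1/2..1/2} G"
    and even: "\<And>v. \<bar>v\<bar> \<le> 1/2 \<Longrightarrow> norm (G v + G (- v) - 2 * G0) \<le> C * v\<^sup>2"
    and k: "k > 0" and \<sigma>: "\<sigma> \<in> {1, -1}"
  shows "norm (integral {-1/2..1/2} (\<lambda>v. G v * exp (\<i> * of_real (\<sigma> * k) * Ln (1 + \<i> * of_real (\<sigma> * v\<^sup>2))))
             - G0 * of_real (sqrt (pi / k))) \<le> 200 * (C + norm G0) / (k * sqrt k)"
proof -
  define K where "K = (\<lambda>v::real. exp (\<i> * of_real (\<sigma> * k) * Ln (1 + \<i> * of_real (\<sigma> * v\<^sup>2))))"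
  \<comment> \<open>The sign of \<open>C\<close> follows from \<open>even\<close> at the point
    \<open>1/2\<close>.\<close>
  have C: "0 \<le> C"
    using order_trans[OF norm_ge_zero even[of "1/2"]] by (simp add: zero_le_mult_iff)
  have contK: "continuous_on {-1/2..1/2} K"
    unfolding K_def by (intro continuous_intros) (auto simp: complex_nonpos_Reals_iff)
  have sq: "v\<^sup>2 \<le> 1/4" if "\<bar>v\<bar> \<le> 1/2" for v :: real
    using that abs_le_square_iff[of v "1/2"] by (simp add: power2_eq_square)
  define Ge where "Ge = (\<lambda>v. (G v + G (- v)) / 2)"
  have GK: "continuous_on {-1/2..1/2} (\<lambda>v. G v * K v)"
    by (intro continuous_intros cont contK)
  have GK': "continuous_on {-1/2..1/2} (\<lambda>v. G (- v) * K (- v))"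
    by (rule continuous_on_compose2[OF GK]) (auto intro!: continuous_intros)
  have Kev: "K (- v) = K v" for v by (simp add: K_def)
  have GeK: "Ge v * K v = (G v * K v + G (- v) * K (- v)) / 2" for v
    by (simp add: Ge_def Kev distrib_right add_divide_distrib)
  have "integral {-1/2..1/2} (\<lambda>v. Ge v * K v)
      = (integral {-1/2..1/2} (\<lambda>v. G v * K v) + integral {-1/2..1/2} (\<lambda>v. G (- v) * K (- v))) / 2"
    unfolding GeK integral_divide
      integral_add[OF integrable_continuous_real[OF GK] integrable_continuous_real[OF GK']] ..
  also have "integral {-1/2..1/2} (\<lambda>v. G (- v) * K (- v)) = integral {-1/2..1/2} (\<lambda>v. G v * K v)"
    using Henstock_Kurzweil_Integration.integral_reflect_real[of "1/2" "-1/2" "\<lambda>v. G v * K v"]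
    by (simp only: minus_divide_left minus_minus)
  finally have sym: "integral {-1/2..1/2} (\<lambda>v. Ge v * K v) = integral {-1/2..1/2} (\<lambda>v. G v * K v)"
    by simp
  have "(\<lambda>v. Ge v * K v) integrable_on {-1/2..1/2}"
    unfolding GeK by (intro integrable_continuous_real continuous_intros GK GK') auto
  then have I1: "((\<lambda>v. if v \<in> {-1/2..1/2} then Ge v * K v else 0) has_integral
      integral {-1/2..1/2} (\<lambda>v. G v * K v)) UNIV"
    by (subst has_integral_restrict_UNIV) (simp only: has_integral_integral flip: sym)
  have "((\<lambda>v. of_real (exp (- k * v\<^sup>2))) has_integral (of_real (sqrt (pi / k)) :: complex)) UNIV"
    using has_integral_linear[OF has_integral_gaussian[OF k] bounded_linear_of_real[where 'a = complex]]
    by (simp add: o_def)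
  then have I2: "((\<lambda>v. G0 * of_real (exp (- k * v\<^sup>2))) has_integral G0 * of_real (sqrt (pi / k))) UNIV"
    by (rule has_integral_mult_right)
  define d where "d = (\<lambda>v. (if v \<in> {-1/2..1/2} then Ge v * K v else 0) - G0 * of_real (exp (- k * v\<^sup>2)))"
  have I3: "(d has_integral (integral {-1/2..1/2} (\<lambda>v. G v * K v) - G0 * of_real (sqrt (pi / k)))) UNIV"
    unfolding d_def by (rule has_integral_diff[OF I1 I2])
  define b where "b = (\<lambda>v. 30 * (C + norm G0) / k * exp (- (k / 8) * v\<^sup>2))"
  have I4: "(b has_integral 30 * (C + norm G0) / k * sqrt (pi / (k / 8))) UNIV"
    unfolding b_def using k by (intro has_integral_mult_right has_integral_gaussian) auto
  have bound: "norm (d v) \<le> b v" for v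
  proof -
    define y where "y = k * v\<^sup>2"
    have y: "y \<ge> 0" using k by (simp add: y_def)
    have v2: "v\<^sup>2 = y / k" using k by (simp add: y_def)
    show ?thesis
    proof (cases "\<bar>v\<bar> \<le> 1/2")
      case True
      have vin: "v \<in> {-1/2..1/2}" using True by (simp only: abs_le_iff) auto
      \<comment> \<open>The decay \<open>exp (- y / 2)\<close> is split as
        \<open>E * exp (- y / 8)\<close>: \<open>E\<close> absorbs the powers of \<open>y\<close>,
        and the rest is the dominating Gaussian in \<open>b\<close>.\<close>
      define E where "E = exp (- (3/8) * y)"
      have q: "v\<^sup>2 \<le> 1/4" by (rule sq[OF True])
      define z where "z = \<i> * of_real \<sigma> * Ln (1 + \<i> * of_real (\<sigma> * v\<^sup>2))"
      have z: "Re z \<le> - v\<^sup>2 / 2" "norm (z - of_real (- v\<^sup>2)) \<le> 2 * (v\<^sup>2)\<^sup>2"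
        using Ln_1_plus_i_real[of "v\<^sup>2" \<sigma>] q \<sigma> unfolding z_def by auto
      have Kz: "K v = exp (of_real k * z)" by (simp add: K_def z_def algebra_simps)
      have rekz: "Re (of_real k * z) \<le> - y / 2"
        using mult_left_mono[OF z(1), of k] k by (simp add: y_def)
      have nK: "norm (K v) \<le> exp (- y / 2)"
        using rekz by (simp add: Kz)
      have "norm (K v - exp (of_real (- k * v\<^sup>2))) \<le> exp (- y / 2) * norm (of_real k * z - of_real (- k * v\<^sup>2))"
        unfolding Kz using rekz y by (intro norm_exp_diff_le) (auto simp: y_def)
      also have "of_real k * z - of_real (- k * v\<^sup>2) = of_real k * (z - of_real (- v\<^sup>2))"
        by (simp add: algebra_simps)
      also have "norm \<dots> \<le> k * (2 * (v\<^sup>2)\<^sup>2)"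
        using z(2) k by (auto simp: norm_mult)
      finally have nK2: "norm (K v - of_real (exp (- k * v\<^sup>2))) \<le> exp (- y / 2) * (k * (2 * (v\<^sup>2)\<^sup>2))"
        unfolding exp_of_real by (simp only: mult_left_mono exp_ge_zero)
      have "d v = (Ge v - G0) * K v + G0 * (K v - of_real (exp (- k * v\<^sup>2)))"
        unfolding d_def if_P[OF vin] by (simp add: algebra_simps)
      also have "norm \<dots> \<le> norm (Ge v - G0) * norm (K v) + norm G0 * norm (K v - of_real (exp (- k * v\<^sup>2)))"
        by (metis norm_mult norm_triangle_ineq)
      also have "\<dots> \<le> C * v\<^sup>2 * exp (- y / 2) + norm G0 * (exp (- y / 2) * (k * (2 * (v\<^sup>2)\<^sup>2)))"
      proof (intro add_mono mult_mono nK nK2)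
        have "Ge v - G0 = (G v + G (- v) - 2 * G0) / 2" by (simp add: Ge_def diff_divide_distrib)
        then have "norm (Ge v - G0) = norm (G v + G (- v) - 2 * G0) / 2"
          by (simp only: norm_divide norm_numeral)
        also have "\<dots> \<le> C * v\<^sup>2"
          using even[OF True] norm_ge_zero[of "G v + G (- v) - 2 * G0"] by linarith
        finally show "norm (Ge v - G0) \<le> C * v\<^sup>2" .
      qed (use C in auto)
      also have "\<dots> = (C * (y * E) + 2 * norm G0 * (y\<^sup>2 * E)) / k * exp (- y / 8)"
      proof -
        have "exp (- y / 2) = E * exp (- y / 8)"
          by (simp add: E_def flip: exp_add)
        moreover have "k * (2 * (v\<^sup>2)\<^sup>2) = 2 * y\<^sup>2 / k"
          unfolding v2 using k by (simp add: field_simps power2_eq_square)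
        ultimately show ?thesis
          by (simp only: v2) (simp add: add_divide_distrib algebra_simps)
      qed
      \<comment> \<open>The values 30 and 15 are generous: the maxima are bounded by
        \<open>8/3\<close> and \<open>128/9\<close>. They are chosen so that both terms carry the
        same factor 30.\<close>
      also have "\<dots> \<le> (C * 30 + 2 * norm G0 * 15) / k * exp (- y / 8)"
      proof (intro mult_right_mono divide_right_mono add_mono mult_left_mono)
        show "y * E \<le> 30"
          using mult_exp_minus_le[of "3/8" y] unfolding E_def by simp
        have "y\<^sup>2 * E \<le> 128 / 9"
          using power2_mult_exp_minus_le[of "3/8" y] y unfolding E_def by (simp add: power2_eq_square)
        then show "y\<^sup>2 * E \<le> 15" by simp
      qed (use C k in auto)
      also have "\<dots> = b v"
        unfolding b_def y_def by (simp add: distrib_left mult.commute)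
      finally show ?thesis .
    next
      case False
      \<comment> \<open>Away from the interval only the Gaussian tail remains;
        \<open>1 \<le> 4 * (y / k)\<close> supplies its factor \<open>1 / k\<close>.\<close>
      have "1/4 \<le> v\<^sup>2"
        using False abs_le_square_iff[of "1/2" v] by (simp add: power2_eq_square)
      then have "1 \<le> 4 * (y / k)" using v2 by linarith
      define E where "E = exp (- (7/8) * y)"
      have Ey: "exp (- y) = E * exp (- y / 8)"
        by (simp add: E_def flip: exp_add)
      have "v \<notin> {-1/2..1/2}" using False by (simp only: abs_le_iff) auto
      then have "d v = - (G0 * of_real (exp (- y)))"
        unfolding d_def y_def by (simp only: if_False) simp
      then have "norm (d v) = norm G0 * exp (- y)"
        by (simp add: norm_mult)
      also have "\<dots> \<le> norm G0 * exp (- y) * (4 * (y / k))"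
        using mult_left_mono[OF \<open>1 \<le> 4 * (y / k)\<close>, of "norm G0 * exp (- y)"]
        by (simp only: mult_1_right) (simp only: norm_ge_zero exp_ge_zero mult_nonneg_nonneg)
      also have "\<dots> = norm G0 * (4 * (y * E)) / k * exp (- y / 8)"
        unfolding Ey by simp
      also have "\<dots> \<le> (30 * (C + norm G0)) / k * exp (- y / 8)"
      proof (intro mult_right_mono divide_right_mono)
        have "4 * (y * E) \<le> 30"
          using mult_exp_minus_le[of "7/8" y] unfolding E_def by simp
        then have "norm G0 * (4 * (y * E)) \<le> norm G0 * 30"
          by (rule mult_left_mono) simp
        then show "norm G0 * (4 * (y * E)) \<le> 30 * (C + norm G0)"
          using C by (simp add: algebra_simps)
      qed (use k in auto)
      also have "\<dots> = b v"
        unfolding b_def y_def by (simp add: distrib_left mult.commute)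
      finally show ?thesis .
    qed
  qed
  have "norm (integral {-1/2..1/2} (\<lambda>v. G v * K v) - G0 * of_real (sqrt (pi / k)))
      \<le> 30 * (C + norm G0) / k * sqrt (pi / (k / 8))"
    using integral_norm_bound_integral[OF has_integral_integrable[OF I3] has_integral_integrable[OF I4] bound]
    unfolding integral_unique[OF I3] integral_unique[OF I4] .
  also have "\<dots> \<le> 30 * (C + norm G0) / k * (6 / sqrt k)"
  proof (rule mult_left_mono)
    have "sqrt (pi * 8) \<le> sqrt (6\<^sup>2)"
      using pi_less_4 by (intro real_sqrt_le_mono) simp
    then have "sqrt (pi * 8) \<le> 6"
      by simp
    then have "sqrt (pi * 8) / sqrt k \<le> 6 / sqrt k"
      using k by (intro divide_right_mono) auto
    then show "sqrt (pi / (k / 8)) \<le> 6 / sqrt k"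
      by (simp add: real_sqrt_divide)
  qed (use C k in auto)
  also have "\<dots> \<le> 200 * (C + norm G0) / (k * sqrt k)"
    using C k by (simp add: divide_right_mono)
  finally show ?thesis unfolding K_def .
qed

text \<open>The linear Taylor terms at \<open>z\<close> and \<open>- z\<close> cancel. Cauchy's
  inequality on discs of radius \<open>1/5\<close>, which stay in the domain as
  \<open>1/2 + 1/5 < 3/4\<close>, bounds the second derivative by
  \<open>2 * B / (1/5)\<^sup>2 = 50 * B\<close>, and there are two remainders.\<close>

lemma holomorphic_even_part_bound:
  fixes G :: "complex \<Rightarrow> complex"
  assumes hol: "G holomorphic_on ball 0 (3/4)"
    and B: "\<And>z. norm z < 3/4 \<Longrightarrow> norm (G z) \<le> B"
    and z: "norm z \<le> 1/2"
  shows "norm (G z + G (- z) - 2 * G 0) \<le> 100 * B * (norm z)\<^sup>2"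
proof -
  have d2: "norm ((deriv ^^ 2) G w) \<le> 50 * B" if "norm w \<le> 1/2" for w
  proof -
    have sub: "norm y < 3/4" if "y \<in> cball w (1/5)" for y
      using that \<open>norm w \<le> 1/2\<close> norm_triangle_ineq2[of y w] by (auto simp: dist_norm norm_minus_commute)
    have "norm ((deriv ^^ 2) G w) \<le> fact 2 * B / (1/5)^2"
      using sub by (intro Cauchy_inequality holomorphic_on_subset[OF hol]
          continuous_on_subset[OF holomorphic_on_imp_continuous_on[OF hol]] B)
        (auto simp: dist_norm less_imp_le)
    then show ?thesis by (simp add: power2_eq_square)
  qed
  have taylor: "norm (G y - (G 0 + deriv G 0 * y)) \<le> 50 * B * (norm y)\<^sup>2" if y: "norm y \<le> 1/2" for y
  proof -
    have "norm ((deriv ^^ 0) G y - (\<Sum>i\<le>1. (deriv ^^ i) G 0 * (y - 0) ^ i / fact i))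
        \<le> 50 * B * norm (y - 0) ^ Suc 1 / fact 1"
    proof (rule complex_Taylor[where S = "cball 0 (1/2)"])
      fix i x assume "x \<in> cball (0::complex) (1/2)"
      then have "(deriv ^^ i) G field_differentiable (at x)"
        by (intro holomorphic_on_imp_differentiable_at[OF holomorphic_higher_deriv[OF hol]]) auto
      then show "((deriv ^^ i) G has_field_derivative (deriv ^^ Suc i) G x) (at x within cball 0 (1/2))"
        by (auto intro: has_field_derivative_at_within simp: field_differentiable_derivI)
    qed (use y d2 in \<open>auto simp: numeral_2_eq_2\<close>)
    then show ?thesis by (simp add: power2_eq_square)
  qed
  have "G z + G (- z) - 2 * G 0 = (G z - (G 0 + deriv G 0 * z)) + (G (- z) - (G 0 + deriv G 0 * (- z)))"
    by (simp add: algebra_simps)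
  also have "norm \<dots> \<le> 50 * B * (norm z)\<^sup>2 + 50 * B * (norm (- z))\<^sup>2"
    using z by (intro norm_triangle_mono taylor) auto
  finally show ?thesis by simp
qed

section \<open>Geometry of the phase\<close>

text \<open>Factor \<open>z - u\<^sup>2\<close> as a difference of squares; the factor
  \<open>csqrt z + u\<close> has real part at least \<open>Re u\<close>, as the principal root has
  nonnegative real part.\<close>

lemma csqrt_diff_le:
  assumes "0 < Re u"
  shows "norm (csqrt z - u) \<le> norm (z - u\<^sup>2) / Re u"
proof -
  have "Re u \<le> Re (csqrt z + u)"
    using Re_csqrt[of z] by simp
  also have "\<dots> \<le> norm (csqrt z + u)"
    by (rule complex_Re_le_cmod)
  finally have "norm (csqrt z - u) * Re u \<le> norm (csqrt z - u) * norm (csqrt z + u)"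
    by (rule mult_left_mono) simp
  also have "\<dots> = norm ((csqrt z)\<^sup>2 - u\<^sup>2)"
    by (simp add: norm_mult[symmetric] algebra_simps power2_eq_square del: power2_csqrt)
  finally show ?thesis
    using assms by (simp add: pos_le_divide_eq)
qed

lemma Im_Ln_eq_arctan:
  assumes "0 < Re z"
  shows "Im (Ln z) = arctan (Im z / Re z)"
  using arg_conv_arctan[OF assms] assms by (subst (asm) Arg_eq_Im_Ln) auto

lemma abs_arctan_le: "\<bar>arctan x\<bar> \<le> \<bar>x\<bar>"
  using arctan_le_self[of "\<bar>x\<bar>"] by (simp add: abs_arctan)

text \<open>The argument of \<open>r * P\<close> does not depend on \<open>r\<close> and has size at
  least \<open>arctan (1/2)\<close>; that of \<open>1 - r * P\<close> has the opposite sign and size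
  at most \<open>arctan (3/10)\<close>. The box for \<open>P\<close> surrounds the limiting start of
  the descent path, with real part \<open>1293/4000\<close> and imaginary part
  \<open>\<sigma> * 707/4000\<close>.\<close>

lemma Im_Ln_segment_ge:
  assumes \<sigma>: "\<sigma> \<in> {1, - 1}" and re: "32/100 \<le> Re P" "Re P \<le> 33/100"
    and im: "17/100 \<le> \<sigma> * Im P" "\<sigma> * Im P \<le> 18/100" and r: "0 < r" "r \<le> 1"
  shows "1/10 \<le> \<sigma> * (Im (Ln (of_real r * P)) + Im (Ln (1 - of_real r * P)))"
proof -
  define b where "b = \<sigma> * Im P"
  have odd: "\<sigma> * arctan (\<sigma> * x) = arctan x" for x
    using \<sigma> by (auto simp: arctan_minus)
  have ImP: "Im P = \<sigma> * b"
    using \<sigma> by (auto simp: b_def)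
  have rre: "r * Re P \<le> 33/100"
    using mult_mono[of r 1 "Re P" "33/100"] r re by simp
  have rb: "r * b \<le> 18/100" "0 \<le> r * b"
    using mult_mono[of r 1 b "18/100"] r im by (auto simp: b_def)
  have "Im (Ln (of_real r * P)) = arctan (\<sigma> * (b / Re P))"
    using re r by (subst Im_Ln_eq_arctan) (auto simp: ImP)
  then have 1: "\<sigma> * Im (Ln (of_real r * P)) = arctan (b / Re P)"
    using odd[of "b / Re P"] by simp
  have "Im (Ln (1 - of_real r * P)) = arctan (\<sigma> * - (r * b / (1 - r * Re P)))"
    using rre by (subst Im_Ln_eq_arctan) (auto simp: ImP mult.left_commute)
  then have 2: "\<sigma> * Im (Ln (1 - of_real r * P)) = - arctan (r * b / (1 - r * Re P))"
    using odd[of "- (r * b / (1 - r * Re P))"] by (simp add: arctan_minus)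
  have "r * b / (1 - r * Re P) \<le> (18/100) / (67/100)"
    using rre rb by (intro frac_le) auto
  then have "arctan (r * b / (1 - r * Re P)) \<le> arctan (3/10)"
    by (intro arctan_monotone') simp
  moreover have "(17/100) / (33/100) \<le> b / Re P"
    using re im by (intro frac_le) (auto simp: b_def)
  then have "arctan (1/2) \<le> arctan (b / Re P)"
    by (intro arctan_monotone') simp
  moreover have "(1/2 - 3/10) / 2 \<le> arctan (1/2) - arctan (3/10)"
    by (rule arctan_diff_ge) auto
  ultimately show ?thesis
    using 1 2 by (simp add: distrib_left)
qed

section \<open>The explicit descent path through the saddle\<close>

text \<open>\<open>\<sigma>\<close> is the sign of the large parameter. The threshold 1000 makes all
  quantities small perturbations of their limits for infinite \<open>\<eta>\<close>, with room for
  the numerical margins below.\<close>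

locale saddle_phase =
  fixes \<eta> :: complex and \<sigma> :: real
  assumes eta: "1000 \<le> norm \<eta>" and sigma: "\<sigma> \<in> {1, - 1}"
begin

definition "w = csqrt (1 - 1 / \<eta>)"
definition "\<tau> = saddle_minus \<eta>"
text \<open>The direction of steepest descent at the saddle. The principal root points to the right,
  so the path runs from the side of 0 to the side of 1.\<close>

definition "\<omega> = csqrt (- \<i> * of_real \<sigma> * (\<tau> * (1 - \<tau>)))"
text \<open>Measures the distortion of the parametrisation by finite \<open>\<eta>\<close>: for
  \<open>\<beta> = 0\<close> the function \<open>x\<close> is the identity.\<close>

definition "\<beta> = \<omega> / (\<eta> - \<tau>)"
text \<open>\<open>x v\<close> is the root of \<open>x\<^sup>2 = v\<^sup>2 (1 - \<beta> x)\<close> that behaves like \<open>v\<close> near \<open>0\<close>.\<close>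

definition "x v = v * csqrt (1 + \<beta>\<^sup>2 * v\<^sup>2 / 4) - \<beta> * v\<^sup>2 / 2"
definition "\<gamma> v = \<tau> + \<omega> * x v"

lemma eta_nz: "\<eta> \<noteq> 0"
  using eta by auto

lemma w_square: "w\<^sup>2 = 1 - 1 / \<eta>"
  by (simp add: w_def)

lemma eta_w: "\<eta> * (1 - w) * (1 + w) = 1"
proof -
  have "\<eta> * (1 - w) * (1 + w) = \<eta> * (1 - w\<^sup>2)"
    by (simp add: algebra_simps power2_eq_square)
  then show ?thesis
    using eta_nz by (simp add: w_square)
qed

lemma w_near: "norm (w - 1) \<le> 1/1000"
proof -
  have "norm (w - 1) \<le> norm (1 / \<eta>)"
    using csqrt_diff_le[of 1 "1 - 1 / \<eta>"] by (simp add: w_def)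
  also have "\<dots> \<le> 1/1000"
    using eta frac_le[of 1 1 1000 "norm \<eta>"] by (simp add: norm_divide)
  finally show ?thesis .
qed

lemma norm_w: "999/1000 \<le> norm w"
  using w_near norm_triangle_ineq2[of 1 "1 - w"] by (simp add: norm_minus_commute)

lemma norm_1_plus_w: "1999/1000 \<le> norm (1 + w)"
  using w_near norm_triangle_ineq2[of 2 "1 - w"] by (simp add: norm_minus_commute)

lemma one_plus_w_nz: "1 + w \<noteq> 0" and w_nz: "w \<noteq> 0"
  using norm_1_plus_w norm_w by auto

text \<open>Rationalising \<open>\<eta> * (1 - w)\<close> removes the cancellation that occurs for
  large \<open>\<eta>\<close>.\<close>

lemma tau_eq: "\<tau> = 1 / (1 + w)"
proof -
  have "\<tau> = \<eta> * (1 - w)"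
    by (simp add: \<tau>_def saddle_minus_def w_def algebra_simps)
  then show ?thesis
    using eta_w one_plus_w_nz by (simp add: eq_divide_eq)
qed

lemma eta_minus_tau: "\<eta> - \<tau> = \<eta> * w"
  by (simp add: \<tau>_def saddle_minus_def w_def)

lemma eta_minus_tau_nz: "\<eta> - \<tau> \<noteq> 0"
  using eta_nz w_nz by (simp add: eta_minus_tau)

lemma tau_near: "norm (\<tau> - 1/2) \<le> 1/1000"
proof -
  have "\<tau> - 1/2 = (1 - w) / (2 * (1 + w))"
    using one_plus_w_nz by (simp add: tau_eq field_simps)
  also have "norm \<dots> = norm (1 - w) / (2 * norm (1 + w))"
    unfolding norm_divide norm_mult norm_numeral ..
  also have "\<dots> \<le> (1/1000) / 1"
    using w_near norm_1_plus_w by (intro frac_le) (auto simp: norm_minus_commute)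
  finally show ?thesis by simp
qed

text \<open>The error is the square of that in \<open>tau_near\<close>, because \<open>1/2\<close>
  is the critical point of \<open>t * (1 - t)\<close>.\<close>

lemma tau_prod: "norm (\<tau> * (1 - \<tau>) - 1/4) \<le> 1/1000000"
proof -
  have "\<tau> * (1 - \<tau>) - 1/4 = - (\<tau> - 1/2)\<^sup>2"
    by (simp add: power2_eq_square algebra_simps)
  then show ?thesis
    using power_mono[OF tau_near, of 2] by (simp add: norm_mult power2_eq_square)
qed

lemma omega_square: "\<omega>\<^sup>2 = - \<i> * of_real \<sigma> * (\<tau> * (1 - \<tau>))"
  unfolding \<omega>_def by (rule power2_csqrt)

text \<open>\<open>707/2000\<close> is a rational approximation of \<open>\<surd>2 / 4\<close>, as \<open>\<omega>\<close> tends to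
  \<open>(1 - i \<sigma>) \<surd>2 / 4\<close> for \<open>\<eta> \<rightarrow> \<infinity>\<close>.\<close>

lemma omega_near: "norm (\<omega> - Complex (707/2000) (- \<sigma> * (707/2000))) \<le> 1/1000"
proof -
  let ?u = "Complex (707/2000) (- \<sigma> * (707/2000))"
  have u2: "?u\<^sup>2 = - \<i> * of_real \<sigma> * (499849/2000000)"
    using sigma by (auto simp: power2_eq_square complex_eq_iff)
  \<comment> \<open>The square of the rational approximation has modulus
    \<open>499849/2000000\<close>, which falls short of \<open>1/4\<close> by
    \<open>151/2000000\<close>.\<close>
  have "- \<i> * of_real \<sigma> * (\<tau> * (1 - \<tau>)) - ?u\<^sup>2
      = - \<i> * of_real \<sigma> * ((\<tau> * (1 - \<tau>) - 1/4) + of_real (151/2000000))"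
    unfolding u2 by (simp add: algebra_simps)
  also have "norm \<dots> = norm ((\<tau> * (1 - \<tau>) - 1/4) + of_real (151/2000000))"
    using sigma by (auto simp: norm_mult)
  also have "\<dots> \<le> 1/1000000 + 151/2000000"
    by (rule norm_triangle_mono[OF tau_prod]) simp
  finally have "norm (- \<i> * of_real \<sigma> * (\<tau> * (1 - \<tau>)) - ?u\<^sup>2) \<le> 1/10000"
    by simp
  then have "norm (- \<i> * of_real \<sigma> * (\<tau> * (1 - \<tau>)) - ?u\<^sup>2) / Re ?u \<le> (1/10000) / (707/2000)"
    by (simp add: divide_right_mono)
  then show ?thesis
    using csqrt_diff_le[of ?u "- \<i> * of_real \<sigma> * (\<tau> * (1 - \<tau>))"] unfolding \<omega>_def by simp
qed

lemma norm_omega: "49/100 \<le> norm \<omega>" "norm \<omega> \<le> 501/1000"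
proof -
  have "norm (\<omega>\<^sup>2) = norm (\<tau> * (1 - \<tau>))"
    using sigma unfolding omega_square by (auto simp: norm_mult)
  then have eq: "(norm \<omega>)\<^sup>2 = norm (\<tau> * (1 - \<tau>))"
    by (simp add: norm_power)
  have "norm (\<tau> * (1 - \<tau>)) \<le> 1/4 + 1/1000000" "1/4 - 1/1000000 \<le> norm (\<tau> * (1 - \<tau>))"
    using tau_prod norm_triangle_ineq2[of "\<tau> * (1 - \<tau>)" "1/4"] norm_triangle_ineq2[of "1/4" "\<tau> * (1 - \<tau>)"]
    by (auto simp: norm_minus_commute)
  then have "(49/100)\<^sup>2 \<le> (norm \<omega>)\<^sup>2" "(norm \<omega>)\<^sup>2 \<le> (501/1000)\<^sup>2"
    unfolding eq by (auto simp: power2_eq_square)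
  then show "49/100 \<le> norm \<omega>" "norm \<omega> \<le> 501/1000"
    by (auto intro: power2_le_imp_le)
qed

lemma Re_omega: "0 < Re \<omega>"
  using abs_Re_le_cmod[of "\<omega> - Complex (707/2000) (- \<sigma> * (707/2000))"] omega_near by auto

lemma norm_beta: "norm \<beta> \<le> 1/1000"
proof -
  have "norm \<beta> = norm \<omega> / (norm \<eta> * norm w)"
    by (simp add: \<beta>_def eta_minus_tau norm_divide norm_mult)
  also have "\<dots> \<le> (501/1000) / (1000 * (999/1000))"
    using norm_omega eta norm_w by (intro frac_le mult_mono) auto
  finally show ?thesis by simp
qed

lemma discr_small:
  assumes "norm v < 1"
  shows "norm (\<beta>\<^sup>2 * v\<^sup>2 / 4) \<le> 1/1000000"
proof -
  have "norm (\<beta>\<^sup>2 * v\<^sup>2 / 4) = (norm \<beta>)\<^sup>2 * (norm v)\<^sup>2 / 4"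
    by (simp add: norm_divide norm_mult norm_power)
  also have "\<dots> \<le> (1/1000)\<^sup>2 * 1\<^sup>2 / 4"
    using norm_beta assms by (intro divide_right_mono mult_mono power_mono) auto
  finally show ?thesis by (simp add: power2_eq_square)
qed

text \<open>Keeps the root in \<open>x\<close> off its branch cut, so that \<open>x\<close> is
  holomorphic on the unit disc.\<close>

lemma discr_not_nonpos:
  assumes "norm v < 1"
  shows "1 + \<beta>\<^sup>2 * v\<^sup>2 / 4 \<notin> \<real>\<^sub>\<le>\<^sub>0"
proof -
  have "\<bar>Re (\<beta>\<^sup>2 * v\<^sup>2 / 4)\<bar> \<le> 1/1000000"
    using discr_small[OF assms] abs_Re_le_cmod order_trans by blast
  then have "0 < Re (1 + \<beta>\<^sup>2 * v\<^sup>2 / 4)"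
    unfolding plus_complex.sel one_complex.sel by linarith
  then show ?thesis
    by (simp only: complex_nonpos_Reals_iff) linarith
qed

lemma discr_nz:
  assumes "norm v < 1"
  shows "1 + \<beta>\<^sup>2 * v\<^sup>2 / 4 \<noteq> 0"
  using discr_not_nonpos[OF assms] by (auto simp del: divide_eq_eq)

lemma csqrt_discr_near:
  assumes "norm v < 1"
  shows "norm (csqrt (1 + \<beta>\<^sup>2 * v\<^sup>2 / 4) - 1) \<le> 1/1000000"
  using csqrt_diff_le[of 1 "1 + \<beta>\<^sup>2 * v\<^sup>2 / 4"] discr_small[OF assms] by simp

lemma x_near:
  assumes v: "norm v < 1"
  shows "norm (x v - v) \<le> norm v / 1000"
proof -
  have "x v - v = v * ((csqrt (1 + \<beta>\<^sup>2 * v\<^sup>2 / 4) - 1) - \<beta> * v / 2)"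
    by (simp add: x_def algebra_simps power2_eq_square)
  moreover have "norm (\<beta> * v / 2) \<le> (1/1000) * 1 / 2"
    using v norm_beta unfolding norm_divide norm_mult
    by (intro frac_le mult_mono) auto
  then have "norm ((csqrt (1 + \<beta>\<^sup>2 * v\<^sup>2 / 4) - 1) - \<beta> * v / 2) \<le> 1/1000"
    using norm_triangle_ineq4[of "csqrt (1 + \<beta>\<^sup>2 * v\<^sup>2 / 4) - 1" "\<beta> * v / 2"] csqrt_discr_near[OF v]
    by simp
  ultimately show ?thesis
    using mult_left_mono[of _ "1/1000" "norm v"] by (simp add: norm_mult)
qed

text \<open>Completing the square in this quadratic equation gives the formula that defines
  \<open>x\<close>.\<close>

lemma x_square: "(x v)\<^sup>2 = v\<^sup>2 * (1 - \<beta> * x v)"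
proof -
  have "(x v + \<beta> * v\<^sup>2 / 2)\<^sup>2 = v\<^sup>2 * (1 + \<beta>\<^sup>2 * v\<^sup>2 / 4)"
    by (simp add: x_def power_mult_distrib)
  then show ?thesis by (simp add: power2_eq_square algebra_simps)
qed

definition "x' v = csqrt (1 + \<beta>\<^sup>2 * v\<^sup>2 / 4)
    + v * (\<beta>\<^sup>2 * v / 2) / (2 * csqrt (1 + \<beta>\<^sup>2 * v\<^sup>2 / 4)) - \<beta> * v"

lemma x_deriv:
  assumes v: "norm v < 1"
  shows "(x has_field_derivative x' v) (at v)"
proof -
  let ?s = "csqrt (1 + \<beta>\<^sup>2 * v\<^sup>2 / 4)"
  have "((\<lambda>v. 1 + \<beta>\<^sup>2 * v\<^sup>2 / 4) has_field_derivative \<beta>\<^sup>2 * v / 2) (at v)"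
    by (auto intro!: derivative_eq_intros)
  from has_field_derivative_csqrt'[OF this discr_not_nonpos[OF v]]
  have "((\<lambda>v. csqrt (1 + \<beta>\<^sup>2 * v\<^sup>2 / 4)) has_field_derivative (\<beta>\<^sup>2 * v / 2) / (2 * ?s)) (at v)"
    by simp
  moreover have "((\<lambda>v. \<beta> * v\<^sup>2 / 2) has_field_derivative \<beta> * v) (at v)"
    by (auto intro!: derivative_eq_intros)
  ultimately have "((\<lambda>v. v * csqrt (1 + \<beta>\<^sup>2 * v\<^sup>2 / 4) - \<beta> * v\<^sup>2 / 2) has_field_derivative
      (1 * ?s + (\<beta>\<^sup>2 * v / 2) / (2 * ?s) * v) - \<beta> * v) (at v)"
    by (intro DERIV_diff DERIV_mult DERIV_ident)
  then show ?thesis unfolding x_def x'_def by (simp add: mult.commute)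
qed

lemma x'_hol: "x' holomorphic_on ball 0 1"
  unfolding x'_def using discr_not_nonpos discr_nz by (intro holomorphic_intros) auto

lemma norm_x'_le:
  assumes v: "norm v < 1"
  shows "norm (x' v) \<le> 2"
proof -
  let ?s = "csqrt (1 + \<beta>\<^sup>2 * v\<^sup>2 / 4)"
  have s: "norm (?s - 1) \<le> 1/1000000" by (rule csqrt_discr_near[OF v])
  have s1: "norm ?s \<le> 1 + 1/1000000" "1/2 \<le> norm ?s"
    using s norm_triangle_ineq2[of ?s 1] norm_triangle_ineq2[of 1 ?s] by (auto simp: norm_minus_commute)
  have "v * (\<beta>\<^sup>2 * v / 2) / (2 * ?s) = (\<beta>\<^sup>2 * v\<^sup>2 / 4) / ?s"
    by (simp add: power2_eq_square)
  also have "norm \<dots> \<le> (1/1000000) / (1/2)"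
    using discr_small[OF v] s1 unfolding norm_divide[of _ ?s] by (intro frac_le) auto
  finally have b: "norm (v * (\<beta>\<^sup>2 * v / 2) / (2 * ?s)) \<le> 1/500000" by simp
  have "norm (\<beta> * v) \<le> (1/1000) * 1"
    using v norm_beta unfolding norm_mult by (intro mult_mono) auto
  then have "norm (x' v) \<le> (1 + 1/1000000) + 1/500000 + 1/1000"
    using norm_triangle_ineq4[of "?s + v * (\<beta>\<^sup>2 * v / 2) / (2 * ?s)" "\<beta> * v"]
      norm_triangle_ineq[of ?s "v * (\<beta>\<^sup>2 * v / 2) / (2 * ?s)"] s1(1) b
    unfolding x'_def by linarith
  then show ?thesis by simp
qed

lemma x_0 [simp]: "x 0 = 0" and x'_0 [simp]: "x' 0 = 1"
  by (simp_all add: x_def x'_def)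

lemma gamma_0 [simp]: "\<gamma> 0 = \<tau>"
  by (simp add: \<gamma>_def)

text \<open>The displacement \<open>\<omega> * x v\<close> has size about \<open>3/8\<close> at
  most, below \<open>2/5\<close>. The radius \<open>3/4\<close> exceeds the half-length
  \<open>1/2\<close> of the parameter interval, which leaves room for the Cauchy estimate of the
  amplitude.\<close>

lemma gamma_in:
  assumes v: "norm v < 3/4"
  shows "\<gamma> v \<in> cball (1/2) (2/5)"
proof -
  have "norm (x v) \<le> norm v + norm v / 1000"
    using x_near[of v] v norm_triangle_ineq2[of "x v" v] by simp
  then have "norm (\<omega> * x v) \<le> (501/1000) * (3/4 + (3/4) / 1000)"
    using norm_omega v unfolding norm_mult by (intro mult_mono) auto
  moreover have "\<gamma> v - 1/2 = (\<tau> - 1/2) + \<omega> * x v"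
    by (simp add: \<gamma>_def)
  ultimately have "norm (\<gamma> v - 1/2) \<le> 1/1000 + (501/1000) * (3/4 + (3/4) / 1000)"
    using norm_triangle_mono[OF tau_near] by metis
  then show ?thesis
    by (simp add: dist_norm norm_minus_commute)
qed

text \<open>Locates both ends of the path. The error collects the shift of the saddle, the distance
  of \<open>x\<close> from the identity and the rational approximation of
  \<open>\<omega>\<close>.\<close>

lemma gamma_half:
  assumes s: "s \<in> {1, - 1}"
  shows "norm (\<gamma> (of_real (s / 2)) - (1/2 + of_real s * Complex (707/4000) (- \<sigma> * (707/4000)))) \<le> 3/1000"
proof -
  let ?v = "of_real (s / 2) :: complex"
  have nv: "norm ?v = 1/2" using s by auto
  have xv: "norm (x ?v - ?v) \<le> 1/2000"
    using x_near[of ?v] nv by simp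
  have e1: "norm (\<omega> * (x ?v - ?v)) \<le> 1 * (1/2000)"
    using norm_omega xv unfolding norm_mult by (intro mult_mono) auto
  have e2: "norm (?v * (\<omega> - Complex (707/2000) (- \<sigma> * (707/2000)))) \<le> (1/2) * (1/1000)"
    using omega_near nv unfolding norm_mult by (intro mult_mono) auto
  have c: "of_real s * Complex (707/4000) (- \<sigma> * (707/4000)) = ?v * Complex (707/2000) (- \<sigma> * (707/2000))"
    by (simp add: complex_eq_iff)
  have "\<gamma> ?v - (1/2 + of_real s * Complex (707/4000) (- \<sigma> * (707/4000)))
      = (\<tau> - 1/2) + (\<omega> * (x ?v - ?v) + ?v * (\<omega> - Complex (707/2000) (- \<sigma> * (707/2000))))"
    unfolding c \<gamma>_def by (simp add: algebra_simps)
  also have "norm \<dots> \<le> 1/1000 + (1 * (1/2000) + (1/2) * (1/1000))"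
    by (intro norm_triangle_mono tau_near e1 e2)
  finally show ?thesis by simp
qed

section \<open>The phase at the saddle, along the path and on the end segments\<close>

lemma unit_ball:
  assumes "t \<in> ball (1/2) (1/2 :: real)"
  shows "0 < Re (t::complex)" "Re t < 1" "norm t < 1"
proof -
  have d: "norm (t - 1/2) < 1/2"
    using assms by (simp add: dist_norm norm_minus_commute)
  then have "\<bar>Re (t - 1/2)\<bar> < 1/2"
    using abs_Re_le_cmod le_less_trans by blast
  then have "\<bar>Re t - 1/2\<bar> < 1/2" by simp
  then show "0 < Re t" "Re t < 1" by linarith+
  show "norm t < 1"
    using d norm_triangle_ineq[of "t - 1/2" "1/2"] by simp
qed

lemma eta_quotient:
  assumes "norm t \<le> 1"
  shows "norm (t / \<eta>) \<le> 1/1000"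
  unfolding norm_divide using assms eta by (intro frac_le) auto

lemma Ln_eta_bound:
  assumes "norm t \<le> 1"
  shows "\<bar>Im (Ln (1 - t / \<eta>))\<bar> \<le> 1/500"
proof -
  have "norm (Ln (1 + - (t / \<eta>))) \<le> 2 * norm (- (t / \<eta>))"
    using eta_quotient[OF assms] by (intro norm_Ln_le) simp
  then show ?thesis
    using eta_quotient[OF assms] abs_Im_le_cmod[of "Ln (1 - t / \<eta>)"] by simp
qed

lemma Re_1_minus_quotient:
  assumes "norm t \<le> 1"
  shows "0 < Re (1 - t / \<eta>)"
proof -
  have "\<bar>Re (t / \<eta>)\<bar> \<le> 1/1000"
    using eta_quotient[OF assms] abs_Re_le_cmod order_trans by blast
  then show ?thesis
    unfolding minus_complex.sel one_complex.sel by linarith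
qed

lemma not_nonpos_if_Re_pos: "0 < Re z \<Longrightarrow> z \<notin> \<real>\<^sub>\<le>\<^sub>0"
  by (auto simp: complex_nonpos_Reals_iff)

lemma S_phase_deriv:
  assumes t: "t \<in> ball (1/2) (1/2)"
  shows "(S_phase \<eta> has_field_derivative - \<i> * (1 / t - 1 / (1 - t) + 1 / (\<eta> - t))) (at t)"
proof -
  note b = unit_ball[OF t]
  have n: "t \<notin> \<real>\<^sub>\<le>\<^sub>0" "1 - t \<notin> \<real>\<^sub>\<le>\<^sub>0" "1 - t / \<eta> \<notin> \<real>\<^sub>\<le>\<^sub>0"
    using b Re_1_minus_quotient[of t] by (auto intro!: not_nonpos_if_Re_pos)
  have "t \<noteq> \<eta>" using b(3) eta by auto
  then have q: "(- (1 / \<eta>)) * inverse (1 - t / \<eta>) = - (1 / (\<eta> - t))"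
    using eta_nz by (simp add: field_simps)
  have "(Ln has_field_derivative inverse t) (at t)"
    using n by (intro has_field_derivative_Ln)
  moreover have "((\<lambda>t. Ln (1 - t)) has_field_derivative (- 1) * inverse (1 - t)) (at t)"
    using n by (auto intro!: derivative_eq_intros simp: field_simps)
  moreover have "((\<lambda>t. Ln (1 - t / \<eta>)) has_field_derivative (- (1 / \<eta>)) * inverse (1 - t / \<eta>)) (at t)"
  proof -
    have "((\<lambda>t. 1 - t / \<eta>) has_field_derivative - (1 / \<eta>)) (at t)"
      using eta_nz by (auto intro!: derivative_eq_intros)
    from DERIV_chain2[OF has_field_derivative_Ln[OF n(3)] this] show ?thesis
      by (simp add: mult.commute)
  qed
  ultimately have "((\<lambda>t. - \<i> * (Ln t + Ln (1 - t) - Ln (1 - t / \<eta>))) has_field_derivative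
      - \<i> * (inverse t + (- 1) * inverse (1 - t) - (- (1 / \<eta>)) * inverse (1 - t / \<eta>))) (at t)"
    by (intro DERIV_cmult DERIV_diff DERIV_add)
  then show ?thesis
    unfolding S_phase_def[abs_def] q by (simp add: inverse_eq_divide)
qed

lemma S_phase_hol: "S_phase \<eta> holomorphic_on ball (1/2) (1/2)"
  unfolding holomorphic_on_open[OF open_ball] using S_phase_deriv by blast

lemma tau_in: "\<tau> \<in> ball (1/2) (1/2)" "\<tau> \<in> cball (1/2) (2/5)"
  using tau_near by (auto simp: dist_norm norm_minus_commute)

lemma tau_nz: "\<tau> \<noteq> 0" and one_minus_tau_nz: "1 - \<tau> \<noteq> 0"
  using unit_ball[OF tau_in(1)] by auto

text \<open>The condition that the derivative in \<open>S_phase_deriv\<close> vanishes at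
  \<open>\<tau>\<close>.\<close>

lemma saddle_equation: "1 / (\<eta> - \<tau>) = 1 / (1 - \<tau>) - 1 / \<tau>"
proof -
  have "1 - \<tau> = w / (1 + w)"
    using one_plus_w_nz by (simp add: tau_eq field_simps)
  then have "1 / (1 - \<tau>) - 1 / \<tau> = (1 + w) / w - (1 + w)"
    by (simp add: tau_eq)
  also have "\<dots> = (1 - w) * (1 + w) / w"
    using w_nz by (simp add: field_simps)
  also have "(1 - w) * (1 + w) = 1 / \<eta>"
    using eta_w eta_nz by (simp add: field_simps)
  finally show ?thesis by (simp add: eta_minus_tau)
qed

text \<open>After the saddle equation is inserted for \<open>1 / (\<eta> - \<tau>)\<close>, the
  squares cancel and only the cross term remains.\<close>

lemma S_phase_deriv2: "(deriv ^^ 2) (S_phase \<eta>) \<tau> = 2 * \<i> / (\<tau> * (1 - \<tau>))"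
proof -
  let ?S' = "\<lambda>t. - \<i> * (1 / t - 1 / (1 - t) + 1 / (\<eta> - t))"
  have "(?S' has_field_derivative - \<i> * (- (1 / \<tau>)\<^sup>2 - (1 / (1 - \<tau>))\<^sup>2 + (1 / (\<eta> - \<tau>))\<^sup>2)) (at \<tau>)"
  proof (intro DERIV_cmult DERIV_add DERIV_diff)
    show "((\<lambda>t. 1 / t) has_field_derivative - (1 / \<tau>)\<^sup>2) (at \<tau>)"
      using tau_nz by (auto intro!: derivative_eq_intros simp: power2_eq_square)
    show "((\<lambda>t. 1 / (1 - t)) has_field_derivative (1 / (1 - \<tau>))\<^sup>2) (at \<tau>)"
      using one_minus_tau_nz by (auto intro!: derivative_eq_intros simp: power2_eq_square)
    show "((\<lambda>t. 1 / (\<eta> - t)) has_field_derivative (1 / (\<eta> - \<tau>))\<^sup>2) (at \<tau>)"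
      using eta_minus_tau_nz by (auto intro!: derivative_eq_intros simp: power2_eq_square)
  qed
  then have d: "(deriv (S_phase \<eta>) has_field_derivative - \<i> * (- (1 / \<tau>)\<^sup>2 - (1 / (1 - \<tau>))\<^sup>2 + (1 / (\<eta> - \<tau>))\<^sup>2)) (at \<tau>)"
    by (rule has_field_derivative_transform_within_open[OF _ open_ball tau_in(1)])
      (use S_phase_deriv in \<open>auto intro: DERIV_imp_deriv[symmetric]\<close>)
  have "(deriv ^^ 2) (S_phase \<eta>) \<tau> = deriv (deriv (S_phase \<eta>)) \<tau>"
    by (simp add: numeral_2_eq_2)
  also have "\<dots> = - \<i> * (- (1 / \<tau>)\<^sup>2 - (1 / (1 - \<tau>))\<^sup>2 + (1 / (1 - \<tau>) - 1 / \<tau>)\<^sup>2)"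
    using DERIV_imp_deriv[OF d] unfolding saddle_equation .
  also have "\<dots> = 2 * \<i> * (1 / \<tau> * (1 / (1 - \<tau>)))"
    by (simp add: power2_eq_square algebra_simps)
  finally show ?thesis by simp
qed

lemma exp_S_phase:
  assumes t: "t \<in> ball (1/2) (1/2)"
  shows "exp (\<i> * S_phase \<eta> t) = t * (1 - t) / (1 - t / \<eta>)"
proof -
  note b = unit_ball[OF t]
  have "t \<noteq> 0" "1 - t \<noteq> 0" "1 - t / \<eta> \<noteq> 0"
    using b Re_1_minus_quotient[of t] by auto
  moreover have "\<i> * S_phase \<eta> t = Ln t + Ln (1 - t) - Ln (1 - t / \<eta>)"
    by (simp add: S_phase_def algebra_simps)
  ultimately show ?thesis
    by (simp add: exp_add exp_diff)
qed

text \<open>The saddle equation turns the term linear in the displacement \<open>u\<close> into a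
  multiple of \<open>q * u\<close>, and the quadratic equation for \<open>x\<close> rewrites
  \<open>D * u\<^sup>2\<close> with the factor \<open>D - u\<close>. That factor then cancels
  against the denominator.\<close>

lemma gamma_ratio:
  assumes v: "norm v < 3/4"
  shows "\<gamma> v * (1 - \<gamma> v) / (1 - \<gamma> v / \<eta>)
    = \<tau> * (1 - \<tau>) / (1 - \<tau> / \<eta>) * (1 + \<i> * of_real \<sigma> * v\<^sup>2)"
proof -
  define D where "D = \<eta> - \<tau>"
  define q where "q = \<tau> * (1 - \<tau>)"
  define u where "u = \<omega> * x v"
  have D: "D \<noteq> 0" using eta_minus_tau_nz by (simp add: D_def)
  have "1 / D = (2 * \<tau> - 1) / q"
    using saddle_equation tau_nz one_minus_tau_nz by (simp add: D_def q_def field_simps)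
  then have sad: "q = D * (2 * \<tau> - 1)"
    using D tau_nz one_minus_tau_nz by (simp add: q_def field_simps)
  have u2: "u\<^sup>2 = - \<i> * of_real \<sigma> * q * (v\<^sup>2 * (1 - \<beta> * x v))"
    by (simp only: u_def power_mult_distrib x_square omega_square q_def)
  have Dx: "D * (1 - \<beta> * x v) = D - u"
    using D by (simp add: \<beta>_def u_def D_def[symmetric] field_simps)
  have Du: "D * u\<^sup>2 = - \<i> * of_real \<sigma> * q * v\<^sup>2 * (D - u)"
    unfolding u2 Dx[symmetric] by (simp only: mult_ac)
  have "\<gamma> v * (1 - \<gamma> v) = q - u * (2 * \<tau> - 1) - u\<^sup>2"
    by (simp add: \<gamma>_def q_def u_def power2_eq_square algebra_simps)
  then have "\<gamma> v * (1 - \<gamma> v) * D = (q - u * (2 * \<tau> - 1) - u\<^sup>2) * D"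
    by (rule arg_cong)
  also have "\<dots> = q * D - u * (D * (2 * \<tau> - 1)) - D * u\<^sup>2"
    by (simp add: algebra_simps)
  also have "\<dots> = q * (D - u) * (1 + \<i> * of_real \<sigma> * v\<^sup>2)"
    unfolding Du sad[symmetric] by (simp add: algebra_simps)
  finally have key: "\<gamma> v * (1 - \<gamma> v) * D = q * (D - u) * (1 + \<i> * of_real \<sigma> * v\<^sup>2)" .
  have g1: "1 - \<gamma> v / \<eta> = (D - u) / \<eta>" and t1: "1 - \<tau> / \<eta> = D / \<eta>"
    using eta_nz by (simp_all add: \<gamma>_def D_def u_def field_simps)
  have "\<gamma> v \<in> ball (1/2) (1/2)"
    using gamma_in[OF v] by auto
  \<comment> \<open>\<open>D - u\<close> is \<open>\<eta> - \<gamma> v\<close>, and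
    \<open>\<eta>\<close> lies far outside the disc.\<close>
  then have Duz: "D - u \<noteq> 0"
    using Re_1_minus_quotient[of "\<gamma> v"] unit_ball(3)[of "\<gamma> v"] g1 by auto
  have "\<gamma> v * (1 - \<gamma> v) / ((D - u) / \<eta>) = (\<gamma> v * (1 - \<gamma> v) * D) * \<eta> / (D * (D - u))"
    using D by simp
  also have "\<dots> = q / (D / \<eta>) * (1 + \<i> * of_real \<sigma> * v\<^sup>2)"
    unfolding key using Duz by simp
  finally show ?thesis
    unfolding g1 t1 q_def[symmetric] .
qed

lemma Re_S_phase: "Re (S_phase \<eta> t) = Im (Ln t) + Im (Ln (1 - t)) - Im (Ln (1 - t / \<eta>))"
  by (simp add: S_phase_def)

text \<open>In the limit of infinite \<open>\<eta>\<close> the saddle is \<open>1/2\<close> and the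
  logarithms are real. The perturbation contributes at most \<open>3/1000\<close> twice and
  \<open>1/500\<close> once.\<close>

lemma abs_Re_S_phase_tau: "\<bar>Re (S_phase \<eta> \<tau>)\<bar> \<le> 1/100"
proof -
  have b: "\<bar>Im (Ln z)\<bar> \<le> 3/1000" if "norm (z - 1/2) \<le> 1/1000" for z :: complex
  proof -
    have "\<bar>Re (z - 1/2)\<bar> \<le> 1/1000" "\<bar>Im (z - 1/2)\<bar> \<le> 1/1000"
      using that abs_Re_le_cmod abs_Im_le_cmod order_trans by blast+
    then have "\<bar>Re z - 1/2\<bar> \<le> 1/1000" and im: "\<bar>Im z\<bar> \<le> 1/1000"
      by simp_all
    then have re: "499/1000 \<le> Re z" by linarith
    note z = re im
    then have "0 < Re z" by linarith
    then have "\<bar>Im (Ln z)\<bar> \<le> \<bar>Im z / Re z\<bar>"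
      unfolding Im_Ln_eq_arctan[OF \<open>0 < Re z\<close>] by (intro abs_arctan_le)
    also have "\<dots> = \<bar>Im z\<bar> / Re z" using z by simp
    also have "\<dots> \<le> (1/1000) / (499/1000)" using z by (intro frac_le) auto
    finally show ?thesis by simp
  qed
  have "norm ((1 - \<tau>) - 1/2) = norm (\<tau> - 1/2)"
    by (simp add: norm_minus_commute)
  then have "norm ((1 - \<tau>) - 1/2) \<le> 1/1000" using tau_near by simp
  from b[OF this] b[OF tau_near] Ln_eta_bound[of \<tau>] unit_ball(3)[OF tau_in(1)]
  show ?thesis unfolding Re_S_phase by linarith
qed

text \<open>By \<open>gamma_ratio\<close> the exponentials agree. The branch is settled by imaginary
  parts: two arguments below \<open>pi / 2\<close> and small remaining terms sum to less than
  \<open>2 * pi\<close>.\<close>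

lemma S_phase_gamma:
  fixes v :: real
  assumes v: "\<bar>v\<bar> \<le> 1/2"
  shows "S_phase \<eta> (\<gamma> (of_real v)) - S_phase \<eta> \<tau> = - \<i> * Ln (1 + \<i> * of_real (\<sigma> * v\<^sup>2))"
proof -
  let ?t = "\<gamma> (of_real v)" and ?z = "\<i> * of_real (\<sigma> * v\<^sup>2)"
  have nv: "norm (of_real v :: complex) < 3/4" using v by simp
  have t: "?t \<in> ball (1/2) (1/2)" using gamma_in[OF nv] by auto
  note b = unit_ball[OF t]
  have v2: "v\<^sup>2 \<le> 1/4"
    using v abs_le_square_iff[of v "1/2"] by (simp add: power2_eq_square)
  have nz: "norm ?z \<le> 1/4"
  proof -
    have "norm ?z = \<bar>\<sigma> * v\<^sup>2\<bar>"
      by (simp only: norm_mult norm_ii norm_of_real mult_1)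
    also have "\<dots> = v\<^sup>2" using sigma by auto
    finally show ?thesis using v2 by simp
  qed
  have "\<i> * (S_phase \<eta> ?t - S_phase \<eta> \<tau>) = Ln (1 + ?z)"
  proof (rule exp_complex_eqI)
    have "\<bar>Im (Ln (1 + ?z))\<bar> \<le> 2 * norm ?z"
      using norm_Ln_le[of ?z] nz abs_Im_le_cmod[of "Ln (1 + ?z)"] by linarith
    then have 1: "\<bar>Im (Ln (1 + ?z))\<bar> \<le> 1/2" using nz by linarith
    have 2: "\<bar>Im (Ln ?t)\<bar> < pi / 2" "\<bar>Im (Ln (1 - ?t))\<bar> < pi / 2"
      by (rule Re_Ln_pos_lt_imp, use b in simp)+
    have 3: "\<bar>Im (Ln (1 - ?t / \<eta>))\<bar> \<le> 1/500"
      using b by (intro Ln_eta_bound) simp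
    have "Im (\<i> * (S_phase \<eta> ?t - S_phase \<eta> \<tau>)) = Re (S_phase \<eta> ?t) - Re (S_phase \<eta> \<tau>)"
      by simp
    then show "\<bar>Im (\<i> * (S_phase \<eta> ?t - S_phase \<eta> \<tau>)) - Im (Ln (1 + ?z))\<bar> < 2 * pi"
      using 1 2 3 abs_Re_S_phase_tau pi_gt3 unfolding Re_S_phase[of ?t] by linarith
    have "1 + ?z \<noteq> 0" by (auto simp: complex_eq_iff)
    then have "exp (Ln (1 + ?z)) = 1 + ?z" by (rule exp_Ln)
    moreover have "\<tau> * (1 - \<tau>) / (1 - \<tau> / \<eta>) \<noteq> 0"
      using exp_S_phase[OF tau_in(1)] by (metis exp_not_eq_zero)
    moreover have "exp (\<i> * (S_phase \<eta> ?t - S_phase \<eta> \<tau>))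
        = (?t * (1 - ?t) / (1 - ?t / \<eta>)) / (\<tau> * (1 - \<tau>) / (1 - \<tau> / \<eta>))"
      unfolding right_diff_distrib exp_diff exp_S_phase[OF t] exp_S_phase[OF tau_in(1)] ..
    ultimately show "exp (\<i> * (S_phase \<eta> ?t - S_phase \<eta> \<tau>)) = exp (Ln (1 + ?z))"
      unfolding gamma_ratio[OF nv] by (simp only: nonzero_mult_div_cancel_left) simp
  qed
  then have "- \<i> * (\<i> * (S_phase \<eta> ?t - S_phase \<eta> \<tau>)) = - \<i> * Ln (1 + ?z)"
    by (rule arg_cong)
  then show ?thesis by simp
qed

text \<open>The sum of \<open>Ln t\<close> and \<open>Ln (1 - t)\<close> is invariant under
  exchanging \<open>t\<close> and \<open>1 - t\<close>, so both end segments are treated at once.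
  The gain \<open>1/10\<close> exceeds the corrections \<open>1/500\<close> and \<open>1/100\<close>
  by more than \<open>1/20\<close>.\<close>

lemma Re_S_phase_segment:
  assumes P: "norm (P - (1/2 - Complex (707/4000) (- \<sigma> * (707/4000)))) \<le> 3/1000"
    and r: "0 < r" "r \<le> 1" and t: "t = of_real r * P \<or> t = 1 - of_real r * P" "norm t \<le> 1"
  shows "\<sigma> * Re (S_phase \<eta> \<tau>) + 1/20 \<le> \<sigma> * Re (S_phase \<eta> t)"
proof -
  let ?d = "P - (1/2 - Complex (707/4000) (- \<sigma> * (707/4000)))"
  have "\<bar>Re ?d\<bar> \<le> 3/1000" "\<bar>Im ?d\<bar> \<le> 3/1000"
    using P abs_Re_le_cmod abs_Im_le_cmod order_trans by blast+
  then have re0: "\<bar>Re P - 1293/4000\<bar> \<le> 3/1000" and im0: "\<bar>Im P - \<sigma> * (707/4000)\<bar> \<le> 3/1000"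
    by simp_all
  have re: "32/100 \<le> Re P" "Re P \<le> 33/100"
    using re0 by linarith+
  have s: "\<sigma> = 1 \<or> \<sigma> = - 1"
    using sigma by auto
  have im: "17/100 \<le> \<sigma> * Im P" "\<sigma> * Im P \<le> 18/100"
    using s im0 by (elim disjE; simp; linarith)+
  have "1/10 \<le> \<sigma> * (Im (Ln t) + Im (Ln (1 - t)))"
    using Im_Ln_segment_ge[OF sigma re im r] t by (auto simp: add.commute)
  moreover have "\<bar>\<sigma> * Im (Ln (1 - t / \<eta>))\<bar> \<le> 1/500" "\<bar>\<sigma> * Re (S_phase \<eta> \<tau>)\<bar> \<le> 1/100"
    using Ln_eta_bound[OF t(2)] abs_Re_S_phase_tau sigma by auto
  ultimately show ?thesis
    unfolding Re_S_phase[of t] right_diff_distrib by linarith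
qed

end

section \<open>The steepest descent estimate\<close>

context saddle_phase
begin

lemma gamma_deriv:
  assumes "norm v < 1"
  shows "(\<gamma> has_field_derivative \<omega> * x' v) (at v)"
  unfolding \<gamma>_def[abs_def] using DERIV_add[OF DERIV_const DERIV_cmult[OF x_deriv[OF assms]]] by simp

text \<open>A crude bound that serves only to establish integrability at the endpoints.\<close>

lemma abs_Re_S_phase_le:
  assumes "t \<in> ball (1/2) (1/2)"
  shows "\<bar>Re (S_phase \<eta> t)\<bar> \<le> 10"
proof -
  note b = unit_ball[OF assms]
  have "\<bar>Im (Ln t)\<bar> < pi / 2" "\<bar>Im (Ln (1 - t))\<bar> < pi / 2"
    by (rule Re_Ln_pos_lt_imp, use b in simp)+
  moreover have "\<bar>Im (Ln (1 - t / \<eta>))\<bar> \<le> 1/500"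
    using b by (intro Ln_eta_bound) simp
  ultimately show ?thesis
    unfolding Re_S_phase using pi_less_4 by linarith
qed

lemma norm_exp_S_phase:
  "norm (exp (- of_real (\<sigma> * k) * S_phase \<eta> t)) = exp (- (k * (\<sigma> * Re (S_phase \<eta> t))))"
  by (simp add: mult_ac)

text \<open>With a primitive \<open>\<Phi>\<close> and its endpoint limits \<open>L0\<close> and
  \<open>L1\<close>, the integral is \<open>L1 - L0\<close>. This telescopes into a segment from 0
  to \<open>P\<close>, the path \<open>\<gamma>\<close> from \<open>P\<close> to
  \<open>1 - Q\<close>, and a segment from \<open>1 - Q\<close> to 1. The path gives the main term,
  the segments are exponentially small.\<close>

lemma steepest_descent_absolute:
  fixes F :: "complex \<Rightarrow> complex" and A c k :: real
  defines "f \<equiv> \<lambda>t. F t * exp (- of_real (\<sigma> * k) * S_phase \<eta> t)"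
  defines "E \<equiv> exp (- of_real (\<sigma> * k) * S_phase \<eta> \<tau>)"
  assumes hol: "F holomorphic_on ball (1/2) (1/2)" and c: "- 1 < c" "c \<le> 0" and k: "1 \<le> k"
    and b0: "\<And>P r. P \<in> cball (1/2) (2/5) \<Longrightarrow> 0 < r \<Longrightarrow> r \<le> 1 \<Longrightarrow> norm (F (of_real r * P)) \<le> A * r powr c"
    and b1: "\<And>P r. P \<in> cball (1/2) (2/5) \<Longrightarrow> 0 < r \<Longrightarrow> r \<le> 1 \<Longrightarrow> norm (F (1 - of_real r * P)) \<le> A * r powr c"
  shows "(\<lambda>t::real. f (of_real t)) absolutely_integrable_on {0..1}"
    and "norm (integral {0..1} (\<lambda>t::real. f (of_real t)) - E * (F \<tau> * \<omega> * of_real (sqrt (pi / k))))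
           \<le> norm E * (60000 * A / (c + 1)) / (k * sqrt k)"
proof -
  let ?U = "ball (1/2) (1/2) :: complex set" and ?D = "cball (1/2) (2/5) :: complex set"
  have fhol: "f holomorphic_on ?U"
    unfolding f_def by (intro holomorphic_intros hol S_phase_hol)
  then obtain \<Phi> where "\<And>z. z \<in> ?U \<Longrightarrow> (\<Phi> has_field_derivative f z) (at z within ?U)"
    using holomorphic_convex_primitive'[OF convex_ball open_ball] by blast
  then have \<Phi>: "\<And>z. z \<in> ?U \<Longrightarrow> (\<Phi> has_field_derivative f z) (at z)"
    by (metis at_within_open open_ball)
  have cone: "of_real r * P \<in> ?U" "1 - of_real r * P \<in> ?U" if "P \<in> ?D" "0 < r" "r \<le> 1" for P r
  proof -
    have "norm (of_real r * P - 1/2) < 1/2"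
      using cone_in_ball(1)[OF that] that by simp
    moreover have "1/2 - (1 - of_real r * P) = of_real r * P - 1/2" by simp
    ultimately show "of_real r * P \<in> ?U" "1 - of_real r * P \<in> ?U"
      by (simp_all add: dist_norm norm_minus_commute[of "1/2" "of_real r * P"])
  qed
  have A0: "0 \<le> A"
    using b0[of "1/2" 1] order_trans[OF norm_ge_zero] by fastforce
  \<comment> \<open>The factor \<open>exp (10 * k)\<close> is harmless: it enters the existence of
    integrals and limits, not the final estimate.\<close>
  have fb: "norm (f t) \<le> norm (F t) * exp (10 * k)" if "t \<in> ?U" for t
  proof -
    have "\<bar>\<sigma> * Re (S_phase \<eta> t)\<bar> \<le> 10" using abs_Re_S_phase_le[OF that] sigma by auto
    then have "- (k * (\<sigma> * Re (S_phase \<eta> t))) \<le> k * 10"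
      using mult_left_mono[of "- (\<sigma> * Re (S_phase \<eta> t))" 10 k] k by simp
    then show ?thesis
      unfolding f_def norm_mult norm_exp_S_phase by (intro mult_left_mono) (auto simp: mult.commute)
  qed
  have fb0: "norm (f (of_real r * P)) \<le> A * exp (10 * k) * r powr c"
    if "P \<in> ?D" "0 < r" "r \<le> 1" for P r
    using order_trans[OF fb[OF cone(1)[OF that]] mult_right_mono[OF b0[OF that], of "exp (10 * k)"]]
    by (simp add: mult_ac)
  have fb1: "norm (f (1 - of_real r * P)) \<le> A * exp (10 * k) * r powr c"
    if "P \<in> ?D" "0 < r" "r \<le> 1" for P r
    using order_trans[OF fb[OF cone(2)[OF that]] mult_right_mono[OF b1[OF that], of "exp (10 * k)"]]
    by (simp add: mult_ac)
  have fcont: "continuous_on ?U f" by (rule holomorphic_on_imp_continuous_on[OF fhol])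
  define J0 where "J0 = (\<lambda>P. integral {0..1} (\<lambda>r::real. f (of_real r * P)))"
  define J1 where "J1 = (\<lambda>P. integral {0..1} (\<lambda>r::real. f (1 - of_real r * P)))"
  obtain L0 where ai0: "\<And>P. P \<in> ?D \<Longrightarrow> (\<lambda>r::real. f (of_real r * P)) absolutely_integrable_on {0..1}"
    and L0: "\<And>P. P \<in> ?D \<Longrightarrow> P * J0 P = \<Phi> P - L0"
    using primitive_limit_at_endpoint[OF c(1) convex_cball \<Phi> fcont, of "1/2" "2/5" 0 "A * exp (10 * k)"]
      cone(1) fb0 unfolding J0_def by auto
  \<comment> \<open>This reflection allows segments at the endpoint 1 to be written as
    \<open>1 - r * P\<close>, in parallel with those at 0.\<close>
  have D1: "1 - P \<in> ?D" if "P \<in> ?D" for P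
  proof -
    have "1/2 - (1 - P) = P - 1/2" by simp
    then show ?thesis using that by (simp add: dist_norm norm_minus_commute)
  qed
  have e1: "1 + of_real r * (P - 1) = 1 - of_real r * (1 - P)" for r :: real and P :: complex
    by (simp add: algebra_simps)
  have "\<exists>L1. \<forall>P\<in>?D. (\<lambda>r::real. f (1 + of_real r * (P - 1))) absolutely_integrable_on {0..1} \<and>
           (P - 1) * integral {0..1} (\<lambda>r. f (1 + of_real r * (P - 1))) = \<Phi> P - L1"
    unfolding e1
    using primitive_limit_at_endpoint[OF c(1) convex_cball \<Phi> fcont, of "1/2" "2/5" 1 "A * exp (10 * k)", unfolded e1]
      cone(2)[OF D1] fb1[OF D1] by blast
  then obtain L1 where "\<And>P. P \<in> ?D \<Longrightarrow> (\<lambda>r::real. f (1 - of_real r * (1 - P))) absolutely_integrable_on {0..1}"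
    and "\<And>P. P \<in> ?D \<Longrightarrow> (P - 1) * J1 (1 - P) = \<Phi> P - L1"
    unfolding e1 J1_def by auto
  note L1' = this
  have ai1: "(\<lambda>r::real. f (1 - of_real r * P)) absolutely_integrable_on {0..1}" if "P \<in> ?D" for P
    using L1'(1)[OF D1[OF that]] by simp
  have L1: "P * J1 P = L1 - \<Phi> (1 - P)" if "P \<in> ?D" for P
  proof -
    have "- (P * J1 P) = \<Phi> (1 - P) - L1" using L1'(2)[OF D1[OF that]] by simp
    then show ?thesis by (simp add: algebra_simps)
  qed
  \<comment> \<open>For \<open>P = 1/2\<close> the two radial segments together make up the real
    interval \<open>[0, 1]\<close>.\<close>
  have half: "1/2 \<in> ?D" by simp
  have resc: "f (of_real (2 * x) * (1/2)) = f (of_real x)" "f (1 - of_real (2 - 2 * x) * (1/2)) = f (of_real x)"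
    for x :: real
    by (simp_all add: algebra_simps)
  have i0: "((\<lambda>r::real. f (of_real r * (1/2))) has_integral J0 (1/2)) {0..1}"
    and i1: "((\<lambda>r::real. f (1 - of_real r * (1/2))) has_integral J1 (1/2)) {0..1}"
    using ai0[OF half] ai1[OF half] unfolding J0_def J1_def
    by (auto simp: absolutely_integrable_on_def simp del: times_divide_eq_right)
  have "((\<lambda>x. f (of_real x)) has_integral ((1/2) *\<^sub>R J0 (1/2) + (1/2) *\<^sub>R J1 (1/2))) {0..1}"
    using has_integral_halves(1)[OF i0] has_integral_halves(2)[OF i1] unfolding resc
    by (intro has_integral_combine[of 0 "1/2" 1]) auto
  also have "(1/2) *\<^sub>R J0 (1/2) + (1/2) *\<^sub>R J1 (1/2) = 1/2 * J0 (1/2) + 1/2 * J1 (1/2)"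
    by (simp add: scaleR_conv_of_real)
  also have "\<dots> = L1 - L0"
    unfolding L0[OF half] L1[OF half] by simp
  finally have I: "((\<lambda>x. f (of_real x)) has_integral (L1 - L0)) {0..1}" by simp
  have "(\<lambda>r::real. norm (f (of_real r * (1/2)))) integrable_on {0..1}"
    "(\<lambda>r::real. norm (f (1 - of_real r * (1/2)))) integrable_on {0..1}"
    using ai0[OF half] ai1[OF half] unfolding absolutely_integrable_on_def by blast+
  then obtain N0 N1 where n0: "((\<lambda>r::real. norm (f (of_real r * (1/2)))) has_integral N0) {0..1}"
    and n1: "((\<lambda>r::real. norm (f (1 - of_real r * (1/2)))) has_integral N1) {0..1}"
    unfolding integrable_on_def by blast
  have "((\<lambda>x. norm (f (of_real x))) has_integral ((1/2) *\<^sub>R N0 + (1/2) *\<^sub>R N1)) {0..1}"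
    using has_integral_halves(1)[OF n0] has_integral_halves(2)[OF n1] unfolding resc
    by (intro has_integral_combine[of 0 "1/2" 1]) auto
  then show "(\<lambda>t::real. f (of_real t)) absolutely_integrable_on {0..1}"
    using I unfolding absolutely_integrable_on_def integrable_on_def by blast

  define P where "P = \<gamma> (- 1/2)"
  define Q where "Q = 1 - \<gamma> (1/2)"
  have gD: "\<gamma> (- 1/2) \<in> ?D" "\<gamma> (1/2) \<in> ?D"
    by (rule gamma_in; simp)+
  have PD: "P \<in> ?D" and QD: "Q \<in> ?D"
    unfolding P_def Q_def using gD D1 by blast+
  define G where "G = (\<lambda>v. F (\<gamma> v) * (\<omega> * x' v))"
  define K where "K = (\<lambda>v::real. exp (\<i> * of_real (\<sigma> * k) * Ln (1 + \<i> * of_real (\<sigma> * v\<^sup>2))))"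
  have fG: "f (\<gamma> (of_real v)) * (\<omega> * x' (of_real v)) = E * (G (of_real v) * K v)"
    if "\<bar>v\<bar> \<le> 1/2" for v :: real
  proof -
    have "- of_real (\<sigma> * k) * S_phase \<eta> (\<gamma> (of_real v))
        = - of_real (\<sigma> * k) * S_phase \<eta> \<tau> - of_real (\<sigma> * k) * (S_phase \<eta> (\<gamma> (of_real v)) - S_phase \<eta> \<tau>)"
      by (simp add: algebra_simps)
    also have "\<dots> = - of_real (\<sigma> * k) * S_phase \<eta> \<tau> + \<i> * of_real (\<sigma> * k) * Ln (1 + \<i> * of_real (\<sigma> * v\<^sup>2))"
      unfolding S_phase_gamma[OF that] by (simp add: algebra_simps)
    finally have "exp (- of_real (\<sigma> * k) * S_phase \<eta> (\<gamma> (of_real v))) = E * K v"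
      by (simp only: E_def K_def exp_add)
    then show ?thesis by (simp only: f_def G_def mult_ac)
  qed
  have "((\<lambda>v::real. f (\<gamma> (of_real v)) * (\<omega> * x' (of_real v))) has_integral
      (\<Phi> (\<gamma> (of_real (1/2))) - \<Phi> (\<gamma> (of_real (- 1/2))))) {- 1/2..1/2}"
  proof (rule fundamental_theorem_of_calculus)
    fix v :: real assume "v \<in> {- 1/2..1/2}"
    then have v: "\<bar>v\<bar> \<le> 1/2" by (auto simp: abs_le_iff)
    have "\<gamma> (of_real v) \<in> ?D" using v by (intro gamma_in) simp
    then have "\<gamma> (of_real v) \<in> ?U" by auto
    then have "((\<lambda>z. \<Phi> (\<gamma> z)) has_field_derivative f (\<gamma> (of_real v)) * (\<omega> * x' (of_real v))) (at (of_real v))"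
      using v by (intro DERIV_chain2[OF \<Phi> gamma_deriv]) auto
    then show "((\<lambda>v. \<Phi> (\<gamma> (of_real v))) has_vector_derivative f (\<gamma> (of_real v)) * (\<omega> * x' (of_real v)))
        (at v within {- 1/2..1/2})"
      by (intro has_vector_derivative_real_field) (rule has_field_derivative_at_within)
  qed simp
  then have "((\<lambda>v::real. E * (G (of_real v) * K v)) has_integral (\<Phi> (1 - Q) - \<Phi> P)) {- 1/2..1/2}"
    by (rule has_integral_eq_rhs[OF has_integral_eq[rotated]])
      (auto simp: P_def Q_def abs_le_iff fG)
  then have mid: "\<Phi> (1 - Q) - \<Phi> P = E * integral {- 1/2..1/2} (\<lambda>v. G (of_real v) * K v)"
    by (subst integral_mult_right[symmetric]) (rule integral_unique[symmetric])
  have FA: "norm (F t) \<le> A" if "t \<in> ?D" for t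
    using b0[OF that, of 1] by simp
  have Ghol: "G holomorphic_on ball 0 (3/4)"
  proof -
    have \<gamma>h: "\<gamma> holomorphic_on ball 0 (3/4)"
      using gamma_deriv by (force simp: holomorphic_on_open)
    have "\<gamma> ` ball 0 (3/4) \<subseteq> ?U"
      using gamma_in by fastforce
    then have "(F \<circ> \<gamma>) holomorphic_on ball 0 (3/4)"
      by (intro holomorphic_on_compose_gen[OF \<gamma>h hol]) auto
    moreover have "x' holomorphic_on ball 0 (3/4)"
      by (rule holomorphic_on_subset[OF x'_hol]) auto
    ultimately show ?thesis
      unfolding G_def o_def by (intro holomorphic_intros)
  qed
  have GB: "norm (G z) \<le> 2 * A" if "norm z < 3/4" for z
  proof -
    have "norm (G z) \<le> A * (1 * 2)"
      unfolding G_def norm_mult using FA[OF gamma_in[OF that]] norm_omega(2) norm_x'_le[of z] that A0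
      by (intro mult_mono) auto
    then show ?thesis by simp
  qed
  have G0: "G 0 = F \<tau> * \<omega>" by (simp add: G_def)
  have "norm (integral {- 1/2..1/2} (\<lambda>v. G (of_real v) * K v) - F \<tau> * \<omega> * of_real (sqrt (pi / k)))
      \<le> 200 * (100 * (2 * A) + norm (F \<tau> * \<omega>)) / (k * sqrt k)"
    unfolding K_def
  proof (rule laplace_kernel_estimate)
    show "continuous_on {- 1/2..1/2} (\<lambda>v. G (of_real v))"
      by (intro continuous_on_compose2[OF holomorphic_on_imp_continuous_on[OF Ghol]] continuous_intros)
        (auto simp: abs_less_iff)
    show "norm (G (of_real v) + G (of_real (- v)) - 2 * (F \<tau> * \<omega>)) \<le> 100 * (2 * A) * v\<^sup>2"
      if "\<bar>v\<bar> \<le> 1/2" for v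
      using holomorphic_even_part_bound[OF Ghol GB, of "of_real v"] that by (simp add: G0)
  qed (use k sigma in auto)
  \<comment> \<open>The amplitude at 0 is at most \<open>A\<close>, since
    \<open>norm \<omega> \<le> 1\<close>; this yields \<open>200 * 201 = 40200\<close>.\<close>
  also have "\<dots> \<le> 200 * (100 * (2 * A) + A) / (k * sqrt k)"
    using GB[of 0] FA[OF tau_in(2)] norm_omega(2) A0 k
    by (intro divide_right_mono mult_left_mono add_left_mono) (auto simp: norm_mult intro: order_trans[OF mult_mono[of _ A _ 1]])
  finally have laplace: "norm (integral {- 1/2..1/2} (\<lambda>v. G (of_real v) * K v) - F \<tau> * \<omega> * of_real (sqrt (pi / k)))
      \<le> 40200 * A / (k * sqrt k)"
    by simp

  have near: "norm (P - (1/2 - Complex (707/4000) (- \<sigma> * (707/4000)))) \<le> 3/1000"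
    "norm (Q - (1/2 - Complex (707/4000) (- \<sigma> * (707/4000)))) \<le> 3/1000"
  proof -
    show "norm (P - (1/2 - Complex (707/4000) (- \<sigma> * (707/4000)))) \<le> 3/1000"
      using gamma_half[of "- 1"] by (simp add: P_def)
    have "Q - (1/2 - Complex (707/4000) (- \<sigma> * (707/4000)))
        = - (\<gamma> (1/2) - (1/2 + Complex (707/4000) (- \<sigma> * (707/4000))))"
      by (simp add: Q_def)
    then show "norm (Q - (1/2 - Complex (707/4000) (- \<sigma> * (707/4000)))) \<le> 3/1000"
      using gamma_half[of 1] by (simp only: norm_minus_cancel) simp
  qed
  define M where "M = norm E * exp (- (k / 20)) * A"
  \<comment> \<open>The phase gain \<open>1/20\<close> along the end segments becomes the factor
    \<open>exp (- (k / 20))\<close> in \<open>M\<close>.\<close>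
  have decay: "norm (f t) \<le> M * r powr c"
    if t: "t \<in> ?U" "norm (F t) \<le> A * r powr c" "\<sigma> * Re (S_phase \<eta> \<tau>) + 1/20 \<le> \<sigma> * Re (S_phase \<eta> t)" for t r
  proof -
    have "- (k * (\<sigma> * Re (S_phase \<eta> t))) \<le> - (k * (\<sigma> * Re (S_phase \<eta> \<tau>))) + - (k / 20)"
      using mult_left_mono[OF t(3), of k] k by (simp add: distrib_left)
    then have "exp (- (k * (\<sigma> * Re (S_phase \<eta> t)))) \<le> norm E * exp (- (k / 20))"
      unfolding E_def norm_exp_S_phase exp_add[symmetric] by (simp only: exp_le_cancel_iff)
    then have "norm (F t) * exp (- (k * (\<sigma> * Re (S_phase \<eta> t)))) \<le> (A * r powr c) * (norm E * exp (- (k / 20)))"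
      using t(2) by (intro mult_mono) (auto intro: order_trans[OF norm_ge_zero])
    then show ?thesis
      unfolding f_def norm_mult norm_exp_S_phase M_def by (simp add: mult_ac)
  qed
  have int_le: "norm (integral {0..1} h) \<le> M / (c + 1)"
    if h: "h absolutely_integrable_on {0..1}" "\<And>r. 0 < r \<Longrightarrow> r < 1 \<Longrightarrow> norm (h r) \<le> M * r powr c" for h :: "real \<Rightarrow> complex"
  proof -
    have p: "((\<lambda>r. M * r powr c) has_integral M * (1 / (c + 1))) {0..1}"
      using has_integral_mult_right[OF has_integral_powr_from_0[OF c(1), of 1], of M] by simp
    have "norm (integral {0<..<1} h) \<le> integral {0<..<1} (\<lambda>r. M * r powr c)"
    proof (rule integral_norm_bound_integral)
      show "h integrable_on {0<..<1}"
        using h(1) by (simp add: absolutely_integrable_on_def flip: integrable_on_Icc_iff_Ioo)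
      show "(\<lambda>r. M * r powr c) integrable_on {0<..<1}"
        using has_integral_integrable[OF p] by (simp only: integrable_on_Icc_iff_Ioo)
    qed (use h(2) in auto)
    then show ?thesis
      using integral_unique[OF p] by (simp add: integral_open_interval_real)
  qed
  have U1: "norm t \<le> 1" if "t \<in> ?U" for t
    using unit_ball(3)[OF that] by simp
  have "norm (J0 P) \<le> M / (c + 1)"
    unfolding J0_def
    using cone(1)[OF PD] b0[OF PD] Re_S_phase_segment[OF near(1)] U1
    by (intro int_le ai0[OF PD] decay) auto
  then have e0: "norm (P * J0 P) \<le> 1 * (M / (c + 1))"
    using cone_in_ball(3)[OF PD, of 1] c unfolding norm_mult by (intro mult_mono) auto
  have "norm (J1 Q) \<le> M / (c + 1)"
    unfolding J1_def
    using cone(2)[OF QD] b1[OF QD] Re_S_phase_segment[OF near(2)] U1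
    by (intro int_le ai1[OF QD] decay) auto
  then have e1: "norm (Q * J1 Q) \<le> 1 * (M / (c + 1))"
    using cone_in_ball(3)[OF QD, of 1] c unfolding norm_mult by (intro mult_mono) auto
  have sk: "1 \<le> sqrt k" "sqrt k \<le> k"
    using k real_sqrt_le_mono[of k "k\<^sup>2"] by (auto simp: power2_eq_square)
  have ksk: "0 < k * sqrt k" using k by simp
  \<comment> \<open>\<open>800 = 2 / (1/20)\<^sup>2\<close>, and
    \<open>k * sqrt k \<le> k\<^sup>2\<close> because \<open>k \<ge> 1\<close>.\<close>
  have expk: "exp (- (k / 20)) \<le> 800 / (k * sqrt k)"
  proof -
    have "k\<^sup>2 * exp (- (k / 20)) \<le> 800"
      using power2_mult_exp_minus_le[of "1/20" k] k by (simp add: power2_eq_square)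
    moreover have "k * sqrt k * exp (- (k / 20)) \<le> k\<^sup>2 * exp (- (k / 20))"
      unfolding power2_eq_square using sk k by (intro mult_right_mono mult_left_mono) auto
    ultimately have "k * sqrt k * exp (- (k / 20)) \<le> 800" by linarith
    then show ?thesis
      unfolding pos_le_divide_eq[OF ksk] by (simp only: mult.commute)
  qed
  define Y where "Y = norm E * (A / (c + 1) / (k * sqrt k))"
  have Y0: "0 \<le> Y" unfolding Y_def using A0 c ksk by simp
  have "M / (c + 1) \<le> norm E * (800 / (k * sqrt k)) * A / (c + 1)"
    unfolding M_def using expk A0 c by (intro divide_right_mono mult_right_mono mult_left_mono) auto
  also have "\<dots> = 800 * Y"
    by (simp add: Y_def mult_ac)
  finally have tail: "M / (c + 1) \<le> 800 * Y" .
  have "A * (c + 1) \<le> A * 1" using A0 c by (intro mult_left_mono) auto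
  then have "A \<le> A / (c + 1)" using c by (simp add: pos_le_divide_eq)
  then have "norm E * (40200 * (A / (k * sqrt k))) \<le> norm E * (40200 * (A / (c + 1) / (k * sqrt k)))"
    using ksk by (intro mult_left_mono divide_right_mono) auto
  then have mid_le: "norm E * (40200 * A / (k * sqrt k)) \<le> 40200 * Y"
    by (simp add: Y_def mult_ac)
  have "L1 - L0 = P * J0 P + Q * J1 Q + (\<Phi> (1 - Q) - \<Phi> P)"
    using L0[OF PD] L1[OF QD] by simp
  then have "L1 - L0 - E * (F \<tau> * \<omega> * of_real (sqrt (pi / k)))
      = (P * J0 P + Q * J1 Q) + E * (integral {- 1/2..1/2} (\<lambda>v. G (of_real v) * K v) - F \<tau> * \<omega> * of_real (sqrt (pi / k)))"
    unfolding mid by (simp add: algebra_simps)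
  also have "norm \<dots> \<le> (1 * (M / (c + 1)) + 1 * (M / (c + 1))) + norm E * (40200 * A / (k * sqrt k))"
    using mult_left_mono[OF laplace norm_ge_zero[of E]]
    by (intro norm_triangle_mono e0 e1) (simp only: norm_mult)
  \<comment> \<open>Two tails of \<open>800 * Y\<close> and the middle part
    \<open>40200 * Y\<close>.\<close>
  also have "\<dots> \<le> 60000 * Y"
    using tail mid_le Y0 by linarith
  also have "\<dots> = norm E * (60000 * A / (c + 1)) / (k * sqrt k)"
    by (simp add: Y_def mult_ac)
  finally show "norm (integral {0..1} (\<lambda>t::real. f (of_real t)) - E * (F \<tau> * \<omega> * of_real (sqrt (pi / k))))
      \<le> norm E * (60000 * A / (c + 1)) / (k * sqrt k)"
    unfolding integral_unique[OF I] by simp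
qed

end

text \<open>The absolute error is divided by the leading term, whose modulus is bounded below
  through \<open>d\<close>, \<open>norm \<omega> \<ge> 49/100\<close> and \<open>pi > 1\<close>. The
  constant comes from \<open>60000 / (49/100) < 130000\<close>.\<close>

lemma steepest_descent_relative:
  fixes F :: "complex \<Rightarrow> complex" and \<eta> :: complex and A c d \<kappa> :: real
  defines "f \<equiv> \<lambda>t::real. F (of_real t) * exp (- of_real \<kappa> * S_phase \<eta> (of_real t))"
  assumes eta: "1000 \<le> norm \<eta>" and \<kappa>: "1 \<le> \<bar>\<kappa>\<bar>"
    and hol: "F holomorphic_on ball (1/2) (1/2)" and c: "- 1 < c" "c \<le> 0"
    and b0: "\<And>P r. P \<in> cball (1/2) (2/5) \<Longrightarrow> 0 < r \<Longrightarrow> r \<le> 1 \<Longrightarrow> norm (F (of_real r * P)) \<le> A * r powr c"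
    and b1: "\<And>P r. P \<in> cball (1/2) (2/5) \<Longrightarrow> 0 < r \<Longrightarrow> r \<le> 1 \<Longrightarrow> norm (F (1 - of_real r * P)) \<le> A * r powr c"
    and d: "0 < d" "d \<le> norm (F (saddle_minus \<eta>))"
  shows "f absolutely_integrable_on {0..1}"
    and "\<exists>R. norm R \<le> 130000 * A / ((c + 1) * d) / \<bar>\<kappa>\<bar> \<and>
           integral {0..1} f = exp (- of_real \<kappa> * S_phase \<eta> (saddle_minus \<eta>)) * F (saddle_minus \<eta>) *
             csqrt (2 * of_real pi / (of_real \<kappa> * (deriv ^^ 2) (S_phase \<eta>) (saddle_minus \<eta>))) * (1 + R)"
proof -
  define \<sigma> where "\<sigma> = sgn \<kappa>"
  define k where "k = \<bar>\<kappa>\<bar>"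
  have \<sigma>: "\<sigma> \<in> {1, - 1}" using \<kappa> by (auto simp: \<sigma>_def sgn_if)
  have k: "1 \<le> k" using \<kappa> by (simp add: k_def)
  have \<kappa>eq: "\<kappa> = \<sigma> * k" by (simp add: \<sigma>_def k_def sgn_mult_abs)
  interpret saddle_phase \<eta> \<sigma>
    by unfold_locales (use eta \<sigma> in auto)
  note est = steepest_descent_absolute[OF hol c k b0 b1, folded \<kappa>eq, folded f_def]
  show "f absolutely_integrable_on {0..1}" by (rule est(1))
  define E where "E = exp (- of_real \<kappa> * S_phase \<eta> \<tau>)"
  define s where "s = sqrt (pi / k)"
  have s: "0 < s" using k by (simp add: s_def)
  \<comment> \<open>Positivity of \<open>Re \<omega>\<close> identifies
    \<open>\<omega> * sqrt (pi / k)\<close> as the principal root, for either sign of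
    \<open>\<kappa>\<close>.\<close>
  have csq: "csqrt (2 * of_real pi / (of_real \<kappa> * (deriv ^^ 2) (S_phase \<eta>) \<tau>)) = \<omega> * of_real s"
  proof (rule csqrt_unique)
    have s2: "(of_real s)\<^sup>2 = (of_real (pi / k) :: complex)"
      unfolding of_real_power[symmetric] s_def using k by simp
    \<comment> \<open>For \<open>q = 0\<close> both sides are 0, as division by zero gives
      0.\<close>
    have "2 * of_real pi / (of_real (\<sigma> * k) * (2 * \<i> / q)) = - \<i> * of_real \<sigma> * q * of_real (pi / k)" for q
      using \<sigma> k by (cases "q = 0") (auto simp: field_simps)
    then show "(\<omega> * of_real s)\<^sup>2 = 2 * of_real pi / (of_real \<kappa> * (deriv ^^ 2) (S_phase \<eta>) \<tau>)"
      unfolding power_mult_distrib omega_square s2 S_phase_deriv2 \<kappa>eq by simp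
    show "0 < Re (\<omega> * of_real s) \<or> Re (\<omega> * of_real s) = 0 \<and> 0 \<le> Im (\<omega> * of_real s)"
      using Re_omega s by simp
  qed
  define m where "m = E * (F \<tau> * \<omega> * of_real s)"
  define X where "X = 60000 * A / (c + 1)"
  have sk: "0 < sqrt k" using k by simp
  have err: "norm (integral {0..1} f - m) \<le> norm E * X / (k * sqrt k)"
    using est(2) by (simp add: m_def E_def s_def X_def)
  have E: "0 < norm E" by (simp add: E_def)
  have A0: "0 \<le> A"
    using b0[of "1/2" 1] order_trans[OF norm_ge_zero] by fastforce
  then have X0: "0 \<le> X"
    using c by (simp add: X_def)
  have s1: "1 / sqrt k \<le> s"
    unfolding s_def real_sqrt_divide using pi_gt3 sk by (intro divide_right_mono) auto
  have dF: "d \<le> norm (F \<tau>)" using d(2) by (simp add: \<tau>_def)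
  have "norm E * (d * (49/100) * (1 / sqrt k)) \<le> norm E * (norm (F \<tau>) * norm \<omega> * s)"
    using dF norm_omega(1) s1 d(1) sk by (intro mult_left_mono mult_mono) auto
  also have "\<dots> = norm m"
    using s by (simp add: m_def norm_mult)
  finally have mlow: "norm E * (d * (49/100) * (1 / sqrt k)) \<le> norm m" .
  have mpos: "0 < norm E * (d * (49/100) * (1 / sqrt k))" using E d(1) sk by simp
  then have m0: "m \<noteq> 0" using mlow by auto
  define R where "R = (integral {0..1} f - m) / m"
  have "norm R \<le> (norm E * X / (k * sqrt k)) / (norm E * (d * (49/100) * (1 / sqrt k)))"
    unfolding R_def norm_divide using err mlow mpos X0 E k by (intro frac_le) auto
  also have "\<dots> = X / (d * (49/100)) / k"
    using E sk d(1) k by (simp add: field_simps)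
  also have "\<dots> \<le> 130000 * A / ((c + 1) * d) / k"
  proof (rule divide_right_mono)
    have "0 \<le> A / ((c + 1) * d)" using A0 c d(1) by simp
    then have "60000 / (49/100) * (A / ((c + 1) * d)) \<le> 130000 * (A / ((c + 1) * d))"
      by (intro mult_right_mono) auto
    then show "X / (d * (49/100)) \<le> 130000 * A / ((c + 1) * d)"
      by (simp add: X_def mult_ac)
  qed (use k in auto)
  finally have "norm R \<le> 130000 * A / ((c + 1) * d) / \<bar>\<kappa>\<bar>" by (simp add: k_def)
  moreover have "integral {0..1} f = m * (1 + R)"
    using m0 by (simp add: R_def field_simps)
  moreover have "m = E * F \<tau> * (\<omega> * of_real s)"
    by (simp add: m_def)
  ultimately show "\<exists>R. norm R \<le> 130000 * A / ((c + 1) * d) / \<bar>\<kappa>\<bar> \<and>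
           integral {0..1} f = exp (- of_real \<kappa> * S_phase \<eta> (saddle_minus \<eta>)) * F (saddle_minus \<eta>) *
             csqrt (2 * of_real pi / (of_real \<kappa> * (deriv ^^ 2) (S_phase \<eta>) (saddle_minus \<eta>))) * (1 + R)"
    unfolding E_def csq[symmetric] unfolding \<tau>_def by auto
qed

section \<open>Boundary values of the parameter function\<close>

text \<open>Both sides square to \<open>4 * l\<^sup>2 - 1\<close>, and the sign is decided by a real
  part. The right-hand side stays continuous up to real points with \<open>norm l < 1/2\<close>,
  which gives access to the shores of the cut.\<close>

lemma root_lam_half_plane:
  fixes l :: complex
  assumes s: "s \<in> {1, - 1 :: real}" and l: "0 < s * Im l"
  shows "root_lam l = of_real s * \<i> * csqrt (1 - 4 * l\<^sup>2)"
proof -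
  define w where "w = csqrt (1 - 4 * l\<^sup>2)"
  have nz: "l \<noteq> 0" using l by auto
  have w2: "w\<^sup>2 = 1 - 4 * l\<^sup>2" by (simp add: w_def)
  have Iml: "Im l \<noteq> 0" using l by auto
  have "0 \<le> Re w" unfolding w_def by (rule Re_csqrt)
  moreover have "Re w \<noteq> 0"
  proof
    assume 0: "Re w = 0"
    have "Im (w\<^sup>2) = - 8 * Re l * Im l" "Re (w\<^sup>2) = 1 - 4 * ((Re l)\<^sup>2 - (Im l)\<^sup>2)"
      unfolding w2 by (simp_all add: power2_eq_square)
    moreover have "Im (w\<^sup>2) = 0" "Re (w\<^sup>2) = - (Im w)\<^sup>2"
      using 0 by (simp_all add: power2_eq_square)
    ultimately have "Re l = 0" "1 + 4 * (Im l)\<^sup>2 = - (Im w)\<^sup>2"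
      using Iml by auto
    then show False
      using zero_le_power2[of "Im l"] zero_le_power2[of "Im w"] by linarith
  qed
  ultimately have Rew: "0 < Re w" by simp
  \<comment> \<open>Imaginary parts of \<open>w\<^sup>2 = 1 - 4 * l\<^sup>2\<close> show that
    \<open>s * (Im w * Re l)\<close> is nonpositive, hence \<open>pos\<close>.\<close>
  have "2 * Re w * Im w = - 8 * Re l * Im l"
    using arg_cong[OF w2, of Im] by (simp add: power2_eq_square)
  then have "(2 * Re w * Im w) * (Re l / 2) = (- 8 * Re l * Im l) * (Re l / 2)"
    by (rule arg_cong)
  then have "Re w * (Im w * Re l) = - 4 * (Re l)\<^sup>2 * Im l"
    by (simp add: power2_eq_square mult_ac)
  then have "Re w * (s * (Im w * Re l)) = - 4 * (Re l)\<^sup>2 * (s * Im l)"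
    by (simp add: mult_ac)
  also have "\<dots> \<le> 0"
    using l by simp
  finally have "s * (Im w * Re l) \<le> 0"
    using Rew by (simp add: mult_le_0_iff)
  moreover have "0 < Re w * (s * Im l)"
    using Rew l by simp
  ultimately have pos: "0 < s * (Re w * Im l - Im w * Re l)"
    by (simp add: algebra_simps)
  have "csqrt (1 - 1 / (4 * l\<^sup>2)) = of_real s * \<i> * w / (2 * l)"
  proof (rule csqrt_unique)
    show "(of_real s * \<i> * w / (2 * l))\<^sup>2 = 1 - 1 / (4 * l\<^sup>2)"
      using s nz by (auto simp: power_divide power_mult_distrib w2 field_simps)
    have "of_real s * \<i> * w / (2 * l) = of_real (s / 2) * (\<i> * (w / l))"
      by simp
    then have "Re (of_real s * \<i> * w / (2 * l)) = - (s / 2) * Im (w / l)"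
      by (simp only: Re_complex_of_real Im_complex_of_real times_complex.sel) simp
    also have "Im (w / l) = (Im w * Re l - Re w * Im l) / ((Re l)\<^sup>2 + (Im l)\<^sup>2)"
      by (rule Im_divide)
    also have "- (s / 2) * \<dots> = s * (Re w * Im l - Im w * Re l) / (2 * ((Re l)\<^sup>2 + (Im l)\<^sup>2))"
      by (simp add: algebra_simps diff_divide_distrib)
    also have "\<dots> > 0"
    proof (rule divide_pos_pos[OF pos])
      have "0 < (Re l)\<^sup>2 + (Im l)\<^sup>2"
        using Iml by (simp add: sum_power2_gt_zero_iff)
      then show "0 < 2 * ((Re l)\<^sup>2 + (Im l)\<^sup>2)"
        by (rule mult_pos_pos[rotated]) simp
    qed
    finally show "0 < Re (of_real s * \<i> * w / (2 * l)) \<or>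
        Re (of_real s * \<i> * w / (2 * l)) = 0 \<and> 0 \<le> Im (of_real s * \<i> * w / (2 * l))" ..
  qed
  then show ?thesis
    using nz unfolding root_lam_def w_def by simp
qed

text \<open>In both cases \<open>(i + root_lam l) / (2 l)\<close> has been rewritten so that the expression stays continuous
  and off the cut of \<open>Ln\<close> up to the real points near \<open>0\<close>.\<close>

definition a_extended :: "real \<Rightarrow> complex \<Rightarrow> complex" where
  "a_extended s l = 1 / (\<i> * of_real pi) *
     (if s = 1 then Ln (\<i> * (1 + csqrt (1 - 4 * l\<^sup>2)) / (2 * l))
      else Ln (\<i> * (2 * l) / (1 + csqrt (1 - 4 * l\<^sup>2))))"

lemma norm_one_plus_csqrt: "1 \<le> norm (1 + csqrt z)"
proof -
  have "1 \<le> Re (1 + csqrt z)"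
    unfolding plus_complex.sel one_complex.sel using Re_csqrt[of z] by linarith
  also have "\<dots> \<le> norm (1 + csqrt z)"
    by (rule complex_Re_le_cmod)
  finally show ?thesis .
qed

lemma one_plus_csqrt_nz: "1 + csqrt z \<noteq> 0"
  using norm_one_plus_csqrt[of z] by (metis norm_zero not_one_le_zero)

text \<open>In the lower half-plane the numerator \<open>1 - csqrt (1 - 4 * l\<^sup>2)\<close>
  vanishes at \<open>l = 0\<close>; multiplying by the conjugate factor moves the root into a
  denominator bounded away from 0.\<close>

lemma a_cut_plane_half_plane:
  assumes s: "s \<in> {1, - 1 :: real}" and l: "0 < s * Im l"
  shows "a_cut_plane l = a_extended s l"
proof -
  let ?w = "csqrt (1 - 4 * l\<^sup>2)"
  have nz: "l \<noteq> 0" using l by auto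
  have "(\<i> + root_lam l) / (2 * l) = (if s = 1 then \<i> * (1 + ?w) / (2 * l) else \<i> * (2 * l) / (1 + ?w))"
  proof (cases "s = 1")
    case True
    then show ?thesis
      using root_lam_half_plane[OF s l] by (simp add: algebra_simps)
  next
    case False
    then have s1: "s = - 1" using s by auto
    have "(1 - ?w) * (1 + ?w) = 1 - ?w\<^sup>2"
      by (simp add: algebra_simps power2_eq_square del: power2_csqrt)
    then have "(1 - ?w) * (1 + ?w) = 4 * l\<^sup>2"
      by simp
    then have "(1 - ?w) = 4 * l\<^sup>2 / (1 + ?w)"
      using one_plus_csqrt_nz by (simp add: eq_divide_eq)
    moreover have "(\<i> + root_lam l) / (2 * l) = \<i> * (1 - ?w) / (2 * l)"
      using root_lam_half_plane[OF s l] s1 by (simp add: algebra_simps)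
    ultimately have "(\<i> + root_lam l) / (2 * l) = \<i> * (4 * l\<^sup>2 / (1 + ?w)) / (2 * l)"
      by (simp only:)
    also have "\<i> * (4 * l\<^sup>2 / D) / (2 * l) = \<i> * (2 * l) / D" for D
      using nz by (simp add: power2_eq_square)
    finally show ?thesis using False by simp
  qed
  then show ?thesis
    unfolding a_cut_plane_def a_extended_def by simp
qed

text \<open>Off the real axis this is the half-plane formula. At real points near 0 the extended
  function is continuous, so its value is the boundary value defining
  \<open>a_shore\<close>.\<close>

lemma a_shore_eq:
  assumes s: "s \<in> {1, - 1 :: real}" and l: "0 \<le> s * Im l" "l \<noteq> 0" "norm l < 1/2"
  shows "a_shore s l = a_extended s l"
proof (cases "Im l = 0")
  case False
  then have "0 < s * Im l" using l s by (auto simp: less_le)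
  moreover have "l \<notin> closed_segment (- 1 / 2) (1 / 2)"
    using False by (auto simp: in_segment)
  ultimately show ?thesis
    using a_cut_plane_half_plane[OF s] by (simp add: a_shore_def)
next
  case True
  define r where "r = Re l"
  have lr: "l = of_real r" using True by (simp add: r_def complex_eq_iff)
  have r: "r \<noteq> 0" "\<bar>r\<bar> < 1/2" using l lr by auto
  have "l = (1 - (r + 1/2)) *\<^sub>R (- 1 / 2) + (r + 1/2) *\<^sub>R (1 / 2)"
    by (simp add: lr scaleR_conv_of_real algebra_simps)
  then have seg: "l \<in> closed_segment (- 1 / 2) (1 / 2)"
    unfolding in_segment using r(2) by (intro exI[of _ "r + 1/2"]) (auto simp: abs_less_iff)
  have r2: "0 < 1 - 4 * r\<^sup>2"
    using r(2) abs_square_less_1[of "2 * r"] by (simp add: power_mult_distrib)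
  have "csqrt (1 - 4 * l\<^sup>2) = csqrt (of_real (1 - 4 * r\<^sup>2))"
    by (simp add: lr)
  also have "\<dots> = of_real (sqrt (1 - 4 * r\<^sup>2))"
    using r2 by (intro csqrt_of_real) simp
  finally have w: "csqrt (1 - 4 * l\<^sup>2) = of_real (sqrt (1 - 4 * r\<^sup>2))" .
  have npos: "1 - 4 * l\<^sup>2 \<notin> \<real>\<^sub>\<le>\<^sub>0"
    using r2 by (auto simp: lr complex_nonpos_Reals_iff power2_eq_square)
  have p: "0 < 1 + sqrt (1 - 4 * r\<^sup>2)"
    using r2 by (intro add_pos_nonneg) auto
  \<comment> \<open>For real \<open>l\<close> the arguments of \<open>Ln\<close> are nonzero and
    purely imaginary, hence off the branch cut.\<close>
  have "\<i> * (1 + csqrt (1 - 4 * l\<^sup>2)) / (2 * l) = \<i> * of_real ((1 + sqrt (1 - 4 * r\<^sup>2)) / (2 * r))"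
    unfolding w by (simp add: lr)
  then have n1: "\<i> * (1 + csqrt (1 - 4 * l\<^sup>2)) / (2 * l) \<notin> \<real>\<^sub>\<le>\<^sub>0"
    using p r by (auto simp: complex_nonpos_Reals_iff)
  have "\<i> * (2 * l) / (1 + csqrt (1 - 4 * l\<^sup>2)) = \<i> * of_real (2 * r / (1 + sqrt (1 - 4 * r\<^sup>2)))"
    unfolding w by (simp add: lr)
  then have n2: "\<i> * (2 * l) / (1 + csqrt (1 - 4 * l\<^sup>2)) \<notin> \<real>\<^sub>\<le>\<^sub>0"
    using p r by (auto simp: complex_nonpos_Reals_iff)
  have "isCont (a_extended s) l"
    unfolding a_extended_def
    using s npos n1 n2 l(2) one_plus_csqrt_nz by (auto intro!: continuous_intros)
  then have "(a_extended s \<longlongrightarrow> a_extended s l) (at l within {z. 0 < s * Im z})"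
    by (simp add: isCont_def tendsto_within_subset[where S = UNIV])
  then have lim: "(a_cut_plane \<longlongrightarrow> a_extended s l) (at l within {z. 0 < s * Im z})"
    by (rule Lim_transform_eventually) (auto simp: eventually_at_filter a_cut_plane_half_plane[OF s])
  \<comment> \<open>\<open>Lim\<close> is determined by convergence only if the filter is
    nontrivial.\<close>
  have "l islimpt {z. 0 < s * Im z}"
    unfolding islimpt_approachable
  proof (intro allI impI)
    fix e :: real assume e: "e > 0"
    let ?z = "l + \<i> * of_real (s * (e / 2))"
    have "s * (s * (e / 2)) = e / 2" using s by auto
    moreover have "Im ?z = s * (e / 2)" using True by simp
    ultimately have "?z \<in> {z. 0 < s * Im z}" using e by (simp only: mem_Collect_eq)
    moreover have "?z \<noteq> l" using e s by auto
    moreover have "dist ?z l < e" using e s by (auto simp: dist_norm norm_mult)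
    ultimately show "\<exists>x'\<in>{z. 0 < s * Im z}. x' \<noteq> l \<and> dist x' l < e" by blast
  qed
  then have "Lim (at l within {z. 0 < s * Im z}) a_cut_plane = a_extended s l"
    using lim by (intro tendsto_Lim) (simp add: trivial_limit_within)
  then show ?thesis
    using seg by (simp add: a_shore_def)
qed

text \<open>The imaginary part of \<open>a\<close> is minus the logarithm of a modulus divided by
  \<open>pi\<close>. That modulus, or its inverse for \<open>s = 1\<close>, is at most
  \<open>2 * norm l \<le> exp (- pi)\<close>.\<close>

lemma abs_Im_a_shore_ge:
  assumes s: "s \<in> {1, - 1 :: real}" and l: "0 \<le> s * Im l" "l \<noteq> 0" "norm l \<le> exp (- pi) / 2"
  shows "1 \<le> \<bar>Im (a_shore s l)\<bar>"
proof -
  let ?w = "csqrt (1 - 4 * l\<^sup>2)"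
  have e: "exp (- pi) < 1" by simp
  have Im: "Im (1 / (\<i> * of_real pi) * Ln z) = - (ln (norm z) / pi)" if "z \<noteq> 0" for z
  proof -
    have "1 / (\<i> * of_real pi) = - \<i> * of_real (1 / pi)" by (simp add: field_simps)
    then show ?thesis using that by (simp only: times_complex.sel) simp
  qed
  have n: "0 < norm l" "2 * norm l \<le> exp (- pi)" using l by auto
  have q: "0 < 2 * norm l / norm (1 + ?w)" "2 * norm l / norm (1 + ?w) \<le> exp (- pi)"
  proof -
    show "0 < 2 * norm l / norm (1 + ?w)"
      using n one_plus_csqrt_nz by (intro divide_pos_pos) auto
    have "2 * norm l / norm (1 + ?w) \<le> exp (- pi) / 1"
      using n norm_one_plus_csqrt by (intro frac_le) auto
    then show "2 * norm l / norm (1 + ?w) \<le> exp (- pi)" by simp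
  qed
  have lnq: "ln (2 * norm l / norm (1 + ?w)) \<le> - pi"
    using ln_mono[OF q(2) q(1)] by simp
  have "\<bar>Im (a_extended s l)\<bar> = \<bar>ln (2 * norm l / norm (1 + ?w))\<bar> / pi"
  proof (cases "s = 1")
    case True
    have "\<i> * (1 + ?w) / (2 * l) \<noteq> 0" using one_plus_csqrt_nz l by auto
    moreover have "norm (\<i> * (1 + ?w) / (2 * l)) = inverse (2 * norm l / norm (1 + ?w))"
      by (simp add: norm_divide norm_mult)
    ultimately have "Im (a_extended s l) = ln (2 * norm l / norm (1 + ?w)) / pi"
      using True Im[of "\<i> * (1 + ?w) / (2 * l)"] q(1) unfolding a_extended_def
      by (simp only: if_True ln_inverse) simp
    then show ?thesis by (simp add: abs_divide)
  next
    case False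
    have "\<i> * (2 * l) / (1 + ?w) \<noteq> 0" using one_plus_csqrt_nz l by auto
    note Im[OF this]
    moreover have "norm (\<i> * (2 * l) / (1 + ?w)) = 2 * norm l / norm (1 + ?w)"
      by (simp add: norm_divide norm_mult)
    ultimately have "Im (a_extended s l) = - (ln (2 * norm l / norm (1 + ?w)) / pi)"
      unfolding a_extended_def if_not_P[OF False] by (simp only:)
    then show ?thesis by (simp add: abs_divide)
  qed
  also have "\<dots> \<ge> 1"
    using lnq by (simp add: pos_le_divide_eq)
  finally show ?thesis
    using a_shore_eq[OF s l(1,2)] n e by simp
qed

section \<open>Uniformity in the parameters\<close>

text \<open>The \<open>O\<close>-term is the explicit remainder \<open>R\<close>, with
  \<open>C\<close> chosen before \<open>l\<close> and \<open>\<eta>\<close>. Boundedness is stated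
  locally uniformly in \<open>t\<close>, which is what the compactness argument uses.\<close>

theorem theorem5p3:
  shows "\<exists>\<epsilon>\<^sub>0>0. \<exists>M\<^sub>0>0. \<forall>\<epsilon> M. 0 < \<epsilon> \<and> \<epsilon> \<le> \<epsilon>\<^sub>0 \<and> M\<^sub>0 \<le> M \<longrightarrow>
    (\<forall>(F :: complex \<Rightarrow> complex \<Rightarrow> complex \<Rightarrow> complex) (c\<^sub>0 :: real) (c\<^sub>1 :: real).
      (\<forall>\<eta>\<in>Omega_plus M. \<forall>l\<in>punctured_ball 0 \<epsilon>. (\<lambda>t. F t \<eta> l) analytic_on ball (1 / 2) (1 / 2)) \<and>
      continuous_on (ball (1 / 2) (1 / 2) \<times> Omega_plus M \<times> punctured_ball 0 \<epsilon>)
        (\<lambda>(t, \<eta>, l). F t \<eta> l) \<and>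
      (\<forall>t\<^sub>0\<in>ball (1 / 2) (1 / 2). \<exists>r>0. \<exists>B. \<forall>t\<in>ball (1 / 2) (1 / 2) \<inter> ball t\<^sub>0 r.
        \<forall>\<eta>\<in>Omega_plus M. \<forall>l\<in>punctured_ball 0 \<epsilon>. norm (F t \<eta> l) \<le> B) \<and>
      c\<^sub>0 > -1 \<and>
      (\<exists>\<delta>>0. \<exists>K. \<forall>t\<in>ball (1 / 2) (1 / 2). norm t < \<delta> \<longrightarrow>
        (\<forall>\<eta>\<in>Omega_plus M. \<forall>l\<in>punctured_ball 0 \<epsilon>. norm (F t \<eta> l) \<le> K * norm t powr c\<^sub>0)) \<and>
      c\<^sub>1 > -1 \<and>
      (\<exists>\<delta>>0. \<exists>K. \<forall>t\<in>ball (1 / 2) (1 / 2). norm (1 - t) < \<delta> \<longrightarrow>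
        (\<forall>\<eta>\<in>Omega_plus M. \<forall>l\<in>punctured_ball 0 \<epsilon>. norm (F t \<eta> l) \<le> K * norm (1 - t) powr c\<^sub>1)) \<and>
      (\<exists>d>0. \<forall>\<eta>\<in>Omega_plus M. \<forall>l\<in>punctured_ball 0 \<epsilon>. d \<le> norm (F (saddle_minus \<eta>) \<eta> l))
      \<longrightarrow>
      (\<forall>s\<in>{1, -1}. \<exists>C. \<forall>\<^sub>F l in at 0 within {l. 0 \<le> s * Im l}. \<forall>\<eta>\<in>Omega_plus M.
        let \<kappa> = Im (a_shore s l);
            f = (\<lambda>t::real. F (of_real t) \<eta> l * exp (- of_real \<kappa> * S_phase \<eta> (of_real t)))
        in f absolutely_integrable_on {0..1} \<and>
           (\<exists>R. norm R \<le> C * (M\<^sup>2 / \<bar>\<kappa>\<bar>) \<and>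
             integral {0..1} f =
               exp (- of_real \<kappa> * S_phase \<eta> (saddle_minus \<eta>)) * F (saddle_minus \<eta>) \<eta> l *
               csqrt (2 * of_real pi / (of_real \<kappa> * (deriv ^^ 2) (S_phase \<eta>) (saddle_minus \<eta>))) *
               (1 + R))))"
proof -
  let ?U = "ball (1/2) (1/2) :: complex set"
  have main: "\<exists>C. \<forall>\<^sub>F l in at 0 within {l. 0 \<le> s * Im l}. \<forall>\<eta>\<in>Omega_plus M.
        let \<kappa> = Im (a_shore s l);
            f = (\<lambda>t::real. F (of_real t) \<eta> l * exp (- of_real \<kappa> * S_phase \<eta> (of_real t)))
        in f absolutely_integrable_on {0..1} \<and>
           (\<exists>R. norm R \<le> C * (M\<^sup>2 / \<bar>\<kappa>\<bar>) \<and>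
             integral {0..1} f =
               exp (- of_real \<kappa> * S_phase \<eta> (saddle_minus \<eta>)) * F (saddle_minus \<eta>) \<eta> l *
               csqrt (2 * of_real pi / (of_real \<kappa> * (deriv ^^ 2) (S_phase \<eta>) (saddle_minus \<eta>))) *
               (1 + R))"
    if \<epsilon>: "0 < \<epsilon>" and M: "1000 \<le> M"
      and an: "\<forall>\<eta>\<in>Omega_plus M. \<forall>l\<in>punctured_ball 0 \<epsilon>. (\<lambda>t. F t \<eta> l) analytic_on ?U"
      and loc: "\<forall>t\<^sub>0\<in>?U. \<exists>r>0. \<exists>B. \<forall>t\<in>?U \<inter> ball t\<^sub>0 r.
        \<forall>\<eta>\<in>Omega_plus M. \<forall>l\<in>punctured_ball 0 \<epsilon>. norm (F t \<eta> l) \<le> B"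
      and c0: "c\<^sub>0 > -1"
      and n0: "0 < \<delta>\<^sub>0" "\<forall>t\<in>?U. norm t < \<delta>\<^sub>0 \<longrightarrow>
        (\<forall>\<eta>\<in>Omega_plus M. \<forall>l\<in>punctured_ball 0 \<epsilon>. norm (F t \<eta> l) \<le> K\<^sub>0 * norm t powr c\<^sub>0)"
      and c1: "c\<^sub>1 > -1"
      and n1: "0 < \<delta>\<^sub>1" "\<forall>t\<in>?U. norm (1 - t) < \<delta>\<^sub>1 \<longrightarrow>
        (\<forall>\<eta>\<in>Omega_plus M. \<forall>l\<in>punctured_ball 0 \<epsilon>. norm (F t \<eta> l) \<le> K\<^sub>1 * norm (1 - t) powr c\<^sub>1)"
      and d: "0 < d" "\<forall>\<eta>\<in>Omega_plus M. \<forall>l\<in>punctured_ball 0 \<epsilon>. d \<le> norm (F (saddle_minus \<eta>) \<eta> l)"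
      and s: "s \<in> {1, - 1}"
    for \<epsilon> M c\<^sub>0 c\<^sub>1 \<delta>\<^sub>0 \<delta>\<^sub>1 K\<^sub>0 K\<^sub>1 d s :: real and F :: "complex \<Rightarrow> complex \<Rightarrow> complex \<Rightarrow> complex"
  proof -
    define I where "I = Omega_plus M \<times> punctured_ball 0 \<epsilon>"
    define F' where "F' = (\<lambda>t i. F t (fst i) (snd i))"
    \<comment> \<open>One exponent serves both endpoints; capping it at 0 makes
      \<open>r powr c \<ge> 1\<close> on the cones.\<close>
    define c where "c = min (min c\<^sub>0 c\<^sub>1) 0"
    have c: "- 1 < c" "c \<le> 0" "c \<le> c\<^sub>0" "c \<le> c\<^sub>1" using c0 c1 by (auto simp: c_def)
    have loc': "\<forall>t\<^sub>0\<in>?U. \<exists>r>0. \<exists>B. \<forall>t\<in>?U \<inter> ball t\<^sub>0 r. \<forall>i\<in>I. norm (F' t i) \<le> B"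
      using loc by (simp add: I_def F'_def)
    have "\<exists>A\<ge>0. \<forall>i\<in>I. \<forall>P\<in>cball (1/2) (2/5). \<forall>r t. 0 < r \<and> r \<le> 1 \<and> t = of_real r * P
           \<longrightarrow> norm (F' t i) \<le> A * r powr c"
      by (rule endpoint_cone_bound[OF loc' _ n0(1) _ c(3,2), where g = "\<lambda>t. t" and K = K\<^sub>0])
        (use n0(2) in \<open>auto simp: I_def F'_def\<close>)
    then obtain A0 where A0: "0 \<le> A0" "\<And>i P r. i \<in> I \<Longrightarrow> P \<in> cball (1/2) (2/5) \<Longrightarrow> 0 < r \<Longrightarrow> r \<le> 1 \<Longrightarrow>
        norm (F' (of_real r * P) i) \<le> A0 * r powr c"
      by blast
    have "\<exists>A\<ge>0. \<forall>i\<in>I. \<forall>P\<in>cball (1/2) (2/5). \<forall>r t. 0 < r \<and> r \<le> 1 \<and> 1 - t = of_real r * P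
           \<longrightarrow> norm (F' t i) \<le> A * r powr c"
    proof (rule endpoint_cone_bound[OF loc' _ n1(1) _ c(4,2), where g = "\<lambda>t. 1 - t" and K = K\<^sub>1])
      fix t :: complex
      have "1 - t - 1/2 = - (t - 1/2)" by simp
      then show "norm (t - 1/2) = norm (1 - t - 1/2)" by (simp only: norm_minus_cancel)
    qed (use n1(2) in \<open>auto simp: I_def F'_def\<close>)
    then obtain A1 where A1: "0 \<le> A1" "\<And>i P r t. i \<in> I \<Longrightarrow> P \<in> cball (1/2) (2/5) \<Longrightarrow> 0 < r \<Longrightarrow> r \<le> 1 \<Longrightarrow>
        1 - t = of_real r * P \<Longrightarrow> norm (F' t i) \<le> A1 * r powr c"
      by blast
    define A where "A = A0 + A1"
    define C where "C = 130000 * A / ((c + 1) * d)"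
    have C0: "0 \<le> C" using A0(1) A1(1) c d(1) by (simp add: C_def A_def)
    have "\<forall>\<^sub>F l in at 0 within {l. 0 \<le> s * Im l}. l \<in> punctured_ball 0 \<epsilon> \<and> 1 \<le> \<bar>Im (a_shore s l)\<bar>"
      unfolding eventually_at
    proof (intro exI[of _ "min \<epsilon> (exp (- pi) / 2)"] conjI ballI impI)
      show "0 < min \<epsilon> (exp (- pi) / 2)" using \<epsilon> by simp
      fix l assume l: "l \<in> {l. 0 \<le> s * Im l}" "l \<noteq> 0 \<and> dist l 0 < min \<epsilon> (exp (- pi) / 2)"
      then show "l \<in> punctured_ball 0 \<epsilon>" by (auto simp: punctured_ball_def)
      show "1 \<le> \<bar>Im (a_shore s l)\<bar>" using l by (intro abs_Im_a_shore_ge[OF s]) auto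
    qed
    then show ?thesis
      unfolding Let_def
    proof (intro exI[of _ C], elim eventually_mono, intro ballI)
      fix l \<eta> assume l: "l \<in> punctured_ball 0 \<epsilon> \<and> 1 \<le> \<bar>Im (a_shore s l)\<bar>" and \<eta>: "\<eta> \<in> Omega_plus M"
      let ?\<kappa> = "Im (a_shore s l)"
      have i: "(\<eta>, l) \<in> I" using l \<eta> by (simp add: I_def)
      have "1000 \<le> norm \<eta>" using \<eta> M by (simp add: Omega_plus_def)
      moreover have "(\<lambda>t. F t \<eta> l) holomorphic_on ?U"
        using an \<eta> l by (simp add: analytic_imp_holomorphic)
      moreover have "norm (F (of_real r * P) \<eta> l) \<le> A * r powr c"
        if "P \<in> cball (1/2) (2/5)" "0 < r" "r \<le> 1" for P r
        using A0(2)[OF i that] A1(1) order_trans[OF _ mult_right_mono[of A0 A "r powr c"]]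
        by (simp add: F'_def A_def)
      moreover have "norm (F (1 - of_real r * P) \<eta> l) \<le> A * r powr c"
        if "P \<in> cball (1/2) (2/5)" "0 < r" "r \<le> 1" for P r
        using A1(2)[OF i that, of "1 - of_real r * P"] A0(1) order_trans[OF _ mult_right_mono[of A1 A "r powr c"]]
        by (simp add: F'_def A_def)
      moreover have "d \<le> norm (F (saddle_minus \<eta>) \<eta> l)" using d(2) \<eta> l by simp
      ultimately have rel: "(\<lambda>t::real. F (of_real t) \<eta> l * exp (- of_real ?\<kappa> * S_phase \<eta> (of_real t)))
            absolutely_integrable_on {0..1}"
          "\<exists>R. norm R \<le> C / \<bar>?\<kappa>\<bar> \<and>
            integral {0..1} (\<lambda>t::real. F (of_real t) \<eta> l * exp (- of_real ?\<kappa> * S_phase \<eta> (of_real t))) =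
              exp (- of_real ?\<kappa> * S_phase \<eta> (saddle_minus \<eta>)) * F (saddle_minus \<eta>) \<eta> l *
              csqrt (2 * of_real pi / (of_real ?\<kappa> * (deriv ^^ 2) (S_phase \<eta>) (saddle_minus \<eta>))) * (1 + R)"
        using steepest_descent_relative[where F = "\<lambda>t. F t \<eta> l" and \<eta> = \<eta> and \<kappa> = ?\<kappa> and A = A and c = c and d = d]
          l c(1,2) d(1) unfolding C_def by blast+
      \<comment> \<open>The error obtained is \<open>O(1 / \<bar>\<kappa>\<bar>)\<close>; the factor
        \<open>M\<^sup>2 \<ge> 1\<close> only weakens it to the stated form.\<close>
      have "C / \<bar>?\<kappa>\<bar> \<le> C * (M\<^sup>2 / \<bar>?\<kappa>\<bar>)"
        using mult_left_mono[of 1 "M\<^sup>2" "C / \<bar>?\<kappa>\<bar>"] C0 M one_le_power[of M 2] by simp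
      then show "(\<lambda>t::real. F (of_real t) \<eta> l * exp (- of_real ?\<kappa> * S_phase \<eta> (of_real t)))
            absolutely_integrable_on {0..1} \<and>
          (\<exists>R. norm R \<le> C * (M\<^sup>2 / \<bar>?\<kappa>\<bar>) \<and>
            integral {0..1} (\<lambda>t::real. F (of_real t) \<eta> l * exp (- of_real ?\<kappa> * S_phase \<eta> (of_real t))) =
              exp (- of_real ?\<kappa> * S_phase \<eta> (saddle_minus \<eta>)) * F (saddle_minus \<eta>) \<eta> l *
              csqrt (2 * of_real pi / (of_real ?\<kappa> * (deriv ^^ 2) (S_phase \<eta>) (saddle_minus \<eta>))) * (1 + R))"
        using rel order_trans by blast
    qed
  qed
  show ?thesis
  \<comment> \<open>The value 1000 is the threshold of \<open>saddle_phase\<close>. Smallness of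
    \<open>l\<close> is enforced by the filter in \<open>main\<close>, so 1 can be taken for the
    bound on \<open>\<epsilon>\<close>.\<close>
  proof (rule exI[of _ 1], rule conjI[OF zero_less_one], rule exI[of _ 1000], rule conjI, simp,
      intro allI impI ballI, elim conjE exE)
  qed (rule main; assumption)
qed

end
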